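(* In the massive setting, let $p\in\mathcal P$ with $d_Qp=0$. Then $p$ is cohomologous (differs by some $d_Qb$, $b\in\mathcal P$) to a polynomial in the traceless variables $R^{(0)}_{\mu\nu;\rho\sigma;\lambda_1\dots\lambda_n}$, $\phi^{(0)}_{\mu\nu;\rho_1\dots\rho_n}$ and $\phi^{(0)}_{;\rho_1\dots\rho_n}$.
   Context: Minkowski metric $\eta=\mathrm{diag}(1,-1,-1,-1)$, mass $m>0$. $\mathcal P$ is the graded-commutative algebra of polynomials in the jet variables (modulo the Klein–Gordon equation $(d^\rho d_\rho+m^2)y=0$) of the fields $h_{\mu\nu}$ (symmetric, even), $v_\mu$ (even), $u_\mu,\tilde u_\mu$ (odd), with formal derivatives $d_\mu$. $d_Q$ is the graded derivation with $d_Qh_{\mu\nu}=-\frac i2(d_\mu u_\nu+d_\nu u_\mu-\eta_{\mu\nu}d_\rho u^\rho)$, $d_Qu_\mu=0$, $d_Q\tilde u_\mu=i(d^\nu h_{\mu\nu}+mv_\mu)$, $d_Qv_\mu=-\frac{im}{2}u_\mu$, $[d_Q,d_\mu]=0$. $h=\eta^{\mu\nu}h_{\mu\nu}$, $\hat h_{\mu\nu}=h_{\mu\nu}-\frac12\eta_{\mu\nu}h$, $\Gamma_{\mu;\nu\rho}=d_\rho\hat h_{\mu\nu}+d_\nu\hat h_{\mu\rho}-d_\mu\hat h_{\nu\rho}$, $R_{\mu\nu;\rho\sigma}=d_\rho\Gamma_{\mu;\nu\sigma}-d_\sigma\Gamma_{\mu;\nu\rho}$; $\phi_{\mu\nu}=d_\mu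 v_\nu+d_\nu v_\mu-\eta_{\mu\nu}d_\rho v^\rho-mh_{\mu\nu}$, $\phi=\eta^{\mu\nu}\phi_{\mu\nu}$. $R^{(0)}_{\mu\nu;\rho\sigma;\lambda_1\dots\lambda_n}$, $\phi^{(0)}_{\mu\nu;\rho_1\dots\rho_n}$, $\phi^{(0)}_{;\rho_1\dots\rho_n}$ denote the traceless parts of $d_{\lambda_1}\cdots d_{\lambda_n}R_{\mu\nu;\rho\sigma}$, $d_{\rho_1}\cdots d_{\rho_n}\phi_{\mu\nu}$, $d_{\rho_1}\cdots d_{\rho_n}\phi$ respectively. *)

theory Defs
  imports Complex_Main "HOL-Library.Multiset" "HOL-Library.Function_Algebras"
begin

datatype idx = I0 | I1 | I2 | I3

lemma UNIV_idx: "(UNIV :: idx set) = {I0, I1, I2, I3}"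
  using idx.exhaust by auto

lemma finite_UNIV_idx: "finite (UNIV :: idx set)"
  by (simp add: UNIV_idx)

text \<open>eta = diag(1,-1,-1,-1); numerically the same for upper and lower indices.\<close>
definition eta :: "idx \<Rightarrow> idx \<Rightarrow> complex" where
  "eta a b = (if a = b then (if a = I0 then 1 else -1) else 0)"

text \<open>Basic fields h_{ab}, v_a (even), u_a, ut_a (odd).  A jet variable is a basic field
  together with the multiset of (commuting) derivative indices applied to it.\<close>
datatype fld = Hf idx idx | Vf idx | Uf idx | UTf idx
datatype jvar = JV fld "idx multiset"

fun is_odd_fld :: "fld \<Rightarrow> bool" where
  "is_odd_fld (Uf _) = True"
| "is_odd_fld (UTf _) = True"
| "is_odd_fld _ = False"

fun is_odd :: "jvar \<Rightarrow> bool" where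
  "is_odd (JV f _) = is_odd_fld f"

text \<open>An element is a complex-valued function on words; polynomials are the finitely
  supported ones. Addition/subtraction/zero are pointwise; multiplication is concatenation.
  The graded-commutative algebra P is the quotient by the ideal Jideal below.\<close>
type_synonym fpoly = "jvar list \<Rightarrow> complex"

definition fin_supp :: "fpoly \<Rightarrow> bool" where
  "fin_supp p \<longleftrightarrow> finite {w. p w \<noteq> 0}"

definition sc :: "complex \<Rightarrow> fpoly \<Rightarrow> fpoly" where
  "sc c p = (\<lambda>w. c * p w)"

definition mono :: "jvar list \<Rightarrow> fpoly" where
  "mono u = (\<lambda>w. if w = u then 1 else 0)"

definition var :: "jvar \<Rightarrow> fpoly" where
  "var x = mono [x]"

definition pone :: fpoly where
  "pone = mono []"

definition pmul :: "fpoly \<Rightarrow> fpoly \<Rightarrow> fpoly" (infixl "\<odot>" 70) where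
  "p \<odot> q = (\<lambda>w. \<Sum>k\<le>length w. p (take k w) * q (drop k w))"

section \<open>Formal derivative d_a (even derivation raising the derivative multiset)\<close>

fun hasidx :: "idx \<Rightarrow> jvar \<Rightarrow> bool" where
  "hasidx a (JV f ms) = (a \<in># ms)"

fun lower :: "idx \<Rightarrow> jvar \<Rightarrow> jvar" where
  "lower a (JV f ms) = JV f (ms - {#a#})"

definition D :: "idx \<Rightarrow> fpoly \<Rightarrow> fpoly" where
  "D a p = (\<lambda>w. \<Sum>i<length w. if hasidx a (w!i) then p (w[i := lower a (w!i)]) else 0)"

definition Dlist :: "idx list \<Rightarrow> fpoly \<Rightarrow> fpoly" where
  "Dlist ls p = foldr D ls p"

text \<open>Several derivatives applied to a linear form (supported on one-letter words).\<close>
definition Dlin :: "idx multiset \<Rightarrow> fpoly \<Rightarrow> fpoly" where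
  "Dlin ms p = (\<lambda>w. case w of [JV g ns] \<Rightarrow> (if ms \<subseteq># ns then p [JV g (ns - ms)] else 0)
                            | _ \<Rightarrow> 0)"

definition fv :: "fld \<Rightarrow> fpoly" where
  "fv f = var (JV f {#})"

abbreviation hF :: "idx \<Rightarrow> idx \<Rightarrow> fpoly" where "hF a b \<equiv> fv (Hf a b)"
abbreviation vF :: "idx \<Rightarrow> fpoly" where "vF a \<equiv> fv (Vf a)"
abbreviation uF :: "idx \<Rightarrow> fpoly" where "uF a \<equiv> fv (Uf a)"
abbreviation utF :: "idx \<Rightarrow> fpoly" where "utF a \<equiv> fv (UTf a)"

definition dQf :: "real \<Rightarrow> fld \<Rightarrow> fpoly" where
  "dQf m f = (case f of
      Hf a b \<Rightarrow> sc (- \<i> / 2) (D a (uF b) + D b (uF a)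
                  - sc (eta a b) (\<Sum>r\<in>UNIV. sc (eta r r) (D r (uF r))))
    | Uf a \<Rightarrow> 0
    | UTf a \<Rightarrow> sc \<i> ((\<Sum>n\<in>UNIV. sc (eta n n) (D n (hF a n))) + sc (of_real m) (vF a))
    | Vf a \<Rightarrow> sc (- \<i> * of_real m / 2) (uF a))"

fun dQvar :: "real \<Rightarrow> jvar \<Rightarrow> fpoly" where
  "dQvar m (JV f ms) = Dlin ms (dQf m f)"

definition psgn :: "jvar \<Rightarrow> complex" where
  "psgn x = (if is_odd x then -1 else 1)"

fun dQword :: "real \<Rightarrow> jvar list \<Rightarrow> fpoly" where
  "dQword m [] = 0"
| "dQword m (x # w) = dQvar m x \<odot> mono w + sc (psgn x) (var x \<odot> dQword m w)"

definition dQ :: "real \<Rightarrow> fpoly \<Rightarrow> fpoly" where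
  "dQ m p = (\<lambda>w'. \<Sum>w\<in>{w. p w \<noteq> 0}. p w * dQword m w w')"

text \<open>Relations: graded commutativity, symmetry of h (with all derivatives), and the
  Klein--Gordon equation (d^r d_r + m^2) y = 0 for every jet variable y.\<close>
definition rels :: "real \<Rightarrow> fpoly set" where
  "rels m =
     {var x \<odot> var y - sc (if is_odd x \<and> is_odd y then -1 else 1) (var y \<odot> var x) | x y. True}
   \<union> {(\<Sum>r\<in>UNIV. sc (eta r r) (var (JV f (ms + {#r, r#})))) + sc (of_real (m^2)) (var (JV f ms))
       | f ms. True}
   \<union> {var (JV (Hf a b) ms) - var (JV (Hf b a) ms) | a b ms. True}"

inductive_set Jideal :: "real \<Rightarrow> fpoly set" for m :: real where
  zero: "0 \<in> Jideal m"
| add: "p \<in> Jideal m \<Longrightarrow> q \<in> Jideal m \<Longrightarrow> p + q \<in> Jideal m"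
| gen: "g \<in> rels m \<Longrightarrow> fin_supp l \<Longrightarrow> fin_supp r \<Longrightarrow> l \<odot> g \<odot> r \<in> Jideal m"

inductive_set alg_gen :: "fpoly set \<Rightarrow> fpoly set" for S :: "fpoly set" where
  one: "pone \<in> alg_gen S"
| base: "s \<in> S \<Longrightarrow> s \<in> alg_gen S"
| add: "p \<in> alg_gen S \<Longrightarrow> q \<in> alg_gen S \<Longrightarrow> p + q \<in> alg_gen S"
| mul: "p \<in> alg_gen S \<Longrightarrow> q \<in> alg_gen S \<Longrightarrow> p \<odot> q \<in> alg_gen S"
| smul: "p \<in> alg_gen S \<Longrightarrow> sc c p \<in> alg_gen S"

definition hh :: fpoly where
  "hh = (\<Sum>a\<in>UNIV. sc (eta a a) (hF a a))"

definition hhat :: "idx \<Rightarrow> idx \<Rightarrow> fpoly" where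
  "hhat a b = hF a b - sc (eta a b / 2) hh"

definition Gam :: "idx \<Rightarrow> idx \<Rightarrow> idx \<Rightarrow> fpoly" where
  "Gam a b c = D c (hhat a b) + D b (hhat a c) - D a (hhat b c)"

definition Rc :: "idx \<Rightarrow> idx \<Rightarrow> idx \<Rightarrow> idx \<Rightarrow> fpoly" where
  "Rc a b c d = D c (Gam a b d) - D d (Gam a b c)"

definition phic :: "real \<Rightarrow> idx \<Rightarrow> idx \<Rightarrow> fpoly" where
  "phic m a b = D a (vF b) + D b (vF a)
     - sc (eta a b) (\<Sum>r\<in>UNIV. sc (eta r r) (D r (vF r))) - sc (of_real m) (hF a b)"

definition phitr :: "real \<Rightarrow> fpoly" where
  "phitr m = (\<Sum>a\<in>UNIV. sc (eta a a) (phic m a a))"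

text \<open>Tensors are functions on index lists (only lists of the right length matter).\<close>
definition Rten :: "idx list \<Rightarrow> fpoly" where
  "Rten i = Dlist (drop 4 i) (Rc (i!0) (i!1) (i!2) (i!3))"

definition phiten :: "real \<Rightarrow> idx list \<Rightarrow> fpoly" where
  "phiten m i = Dlist (drop 2 i) (phic m (i!0) (i!1))"

definition phitrten :: "real \<Rightarrow> idx list \<Rightarrow> fpoly" where
  "phitrten m i = Dlist i (phitr m)"

definition traceless :: "nat \<Rightarrow> (idx list \<Rightarrow> fpoly) \<Rightarrow> bool" where
  "traceless k T \<longleftrightarrow> (\<forall>i a b. length i = k \<longrightarrow> a < b \<longrightarrow> b < k \<longrightarrow>
      (\<Sum>r\<in>UNIV. sc (eta r r) (T (i[a := r, b := r]))) = 0)"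

definition remove2 :: "nat \<Rightarrow> nat \<Rightarrow> idx list \<Rightarrow> idx list" where
  "remove2 a b i = [i!j. j \<leftarrow> [0..<length i], j \<noteq> a \<and> j \<noteq> b]"

definition trace_span :: "nat \<Rightarrow> (idx list \<Rightarrow> fpoly) \<Rightarrow> bool" where
  "trace_span k X \<longleftrightarrow> (\<exists>S. \<forall>i. length i = k \<longrightarrow>
      X i = (\<Sum>(a, b)\<in>{(a, b). a < b \<and> b < k}. sc (eta (i!a) (i!b)) (S a b (remove2 a b i))))"

text \<open>T0 is the traceless part of T: T0 traceless and T - T0 a combination of metric terms
  (this decomposition is unique).\<close>
definition is_traceless_part :: "nat \<Rightarrow> (idx list \<Rightarrow> fpoly) \<Rightarrow> (idx list \<Rightarrow> fpoly) \<Rightarrow> bool" where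
  "is_traceless_part k T T0 \<longleftrightarrow> traceless k T0 \<and> trace_span k (\<lambda>i. T i - T0 i)"

definition traceless_vars :: "real \<Rightarrow> fpoly set" where
  "traceless_vars m =
     {T0 i | T0 i n. length i = 4 + n \<and> is_traceless_part (4 + n) Rten T0}
   \<union> {T0 i | T0 i n. length i = 2 + n \<and> is_traceless_part (2 + n) (phiten m) T0}
   \<union> {T0 i | T0 i n. length i = n \<and> is_traceless_part n (phitrten m) T0}"

end

theory Submission
  imports Defs
begin

text \<open>
  The differential is linear on jet variables.  There is a second odd derivation K commuting with the
  formal derivatives, given by
  $K h = K \tilde u = 0$, $K v_\mu = -(i/m) \tilde u_\mu$,
  $K u_\mu = -(2i/m^2) d^\nu h_{\mu\nu}$, such that, modulo the relations, the even derivation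
  $N = d_Q K + K d_Q$ is the identity on the jets of $u, \tilde u, v$ and a projection on those of
  $h$.  So every polynomial splits into eigenvectors of N with eigenvalues 0, 1, 2, ..., and a
  cocycle is cohomologous to its component of eigenvalue 0, a polynomial in the jets of
  $h_{\mu\nu} - N h_{\mu\nu}$, which are $-\phi_{\mu\nu}/m$ up to exact terms.  Every trace of a
  derivative of $\phi_{\mu\nu}$ is a derivative of $\phi$, or contains the divergence of $\phi_{\mu\nu}$,
  which is exact, or loses two derivatives by the Klein-Gordon equation; induction on the number of
  derivatives replaces all jets of $\phi_{\mu\nu}$ by their traceless parts.
\<close>

section \<open>The free algebra\<close>

text \<open>The differential sends both v and the divergence of h to multiples of u:
  \<open>dQ\<close> of v is -(i m/2) u, and on the divergence it gives -(i/2) times the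
  d'Alembertian of u, which Klein-Gordon turns into (i m^2/2) u. The homotopy pairs u with the
  divergence, which leaves v free as the partner of ut. The constants follow: (-2i/m^2)(i m^2/2) = 1
  on u, (i m)(-i/m) = 1 on ut, and on v the divergence terms of \<open>dQ K\<close> and
  \<open>K dQ\<close> have the coefficients 1/m and -1/m and cancel. Nilpotency of \<open>dQ\<close>
  and the eigenvalue equation for u hold only modulo Klein-Gordon. No normal form is chosen for the
  quotient: representatives in the free algebra are carried along with errors in
  \<open>Jideal m\<close>, which is therefore shown to be stable under \<open>dQ\<close>,
  \<open>K\<close>, \<open>N\<close> and the parity automorphism. That the component of eigenvalue 0
  is a polynomial in the right variables up to exact terms cannot be read off from its eigenvalue;
  the predicate \<open>reducible\<close> records it while the splitting is built.\<close>

lemma sum_idx: "(\<Sum>r\<in>UNIV. f (r::idx)) = f I0 + f I1 + f I2 + f I3"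
  for f :: "idx \<Rightarrow> 'a::comm_monoid_add"
  by (simp add: UNIV_idx add.assoc)

lemma sum_fpoly_apply: "(\<Sum>i\<in>A. f i) w = (\<Sum>i\<in>A. f i w)" for f :: "'i \<Rightarrow> fpoly"
  by (induction A rule: infinite_finite_induct) auto

text \<open>Induction and unification leave goals with eta-expanded polynomials; evaluating these at words
  has to be explicit, otherwise the simplifier pushes the evaluation through every equation.\<close>
lemmas fpoly_apply = zero_fun_apply plus_fun_apply minus_apply uminus_apply sum_fpoly_apply

declare zero_fun_apply [simp del] plus_fun_apply [simp del] minus_apply [simp del]
  uminus_apply [simp del]

lemma sc_simps [simp]:
  "sc c 0 = 0" "sc 0 p = 0" "sc 1 p = p" "sc c (sc d p) = sc (c * d) p"
  by (auto simp: sc_def fpoly_apply fun_eq_iff)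

lemma sc_linear:
  "sc c (p + q) = sc c p + sc c q" "sc c (p - q) = sc c p - sc c q" "sc c (- p) = - sc c p"
  "sc (c + d) p = sc c p + sc d p" "sc (c - d) p = sc c p - sc d p" "sc (- c) p = - sc c p"
  by (auto simp: sc_def fpoly_apply fun_eq_iff algebra_simps)

lemma sc_sum: "sc c (\<Sum>i\<in>A. f i) = (\<Sum>i\<in>A. sc c (f i))"
  by (induction A rule: infinite_finite_induct) (auto simp: sc_linear)

lemma sum_sc: "(\<Sum>i\<in>A. sc (f i) p) = sc (\<Sum>i\<in>A. f i) p"
  by (induction A rule: infinite_finite_induct) (auto simp: sc_linear)

section \<open>The concatenation product\<close>

lemma pmul_Nil: "(p \<odot> q) [] = p [] * q []"
  by (simp add: pmul_def)

text \<open>Splitting off the empty prefix leaves a product with the left shift of \<open>p\<close>.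
  This turns identities for the convolution sum into inductions over the word with \<open>p\<close>
  arbitrary.\<close>

lemma pmul_Cons: "(p \<odot> q) (x # w) = p [] * q (x # w) + ((\<lambda>v. p (x # v)) \<odot> q) w"
  unfolding pmul_def by (simp only: length_Cons sum.atMost_Suc_shift) simp

lemma pmul_linear:
  "(p + p') \<odot> q = p \<odot> q + p' \<odot> q" "q \<odot> (p + p') = q \<odot> p + q \<odot> p'"
  "(p - p') \<odot> q = p \<odot> q - p' \<odot> q" "q \<odot> (p - p') = q \<odot> p - q \<odot> p'"
  "(- p) \<odot> q = - (p \<odot> q)" "q \<odot> (- p) = - (q \<odot> p)"
  "sc c p \<odot> q = sc c (p \<odot> q)" "q \<odot> sc c p = sc c (q \<odot> p)"
  by (auto simp: pmul_def sc_def fpoly_apply fun_eq_iff algebra_simps sum.distrib sum_subtractf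
      sum_distrib_left sum_negf)

lemma pmul_zero [simp]: "0 \<odot> q = 0" "q \<odot> 0 = 0"
  by (auto simp: pmul_def fpoly_apply fun_eq_iff)

lemma pmul_sum_right: "q \<odot> (\<Sum>i\<in>A. f i) = (\<Sum>i\<in>A. q \<odot> f i)"
  by (induction A rule: infinite_finite_induct) (auto simp: pmul_linear)

lemma pmul_assoc: "p \<odot> q \<odot> r = p \<odot> (q \<odot> r)"
proof
  fix w show "(p \<odot> q \<odot> r) w = (p \<odot> (q \<odot> r)) w"
  proof (induction w arbitrary: p)
    case Nil
    then show ?case by (simp add: pmul_Nil)
  next
    case (Cons x w)
    have "(\<lambda>v. (p \<odot> q) (x # v)) = sc (p []) (\<lambda>v. q (x # v)) + (\<lambda>v. p (x # v)) \<odot> q"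
      by (auto simp: fpoly_apply fun_eq_iff pmul_Cons sc_def)
    then show ?case
      by (simp add: pmul_Cons[of _ _ x w] pmul_Nil pmul_linear)
        (simp add: sc_def fpoly_apply algebra_simps Cons.IH)
  qed
qed

lemma mono_Nil_pmul [simp]: "mono [] \<odot> p = p" "p \<odot> mono [] = p"
proof -
  show "mono [] \<odot> p = p"
  proof
    fix w
    have "(\<lambda>v. mono [] (x # v)) = 0" for x by (auto simp: fpoly_apply mono_def fun_eq_iff)
    then show "(mono [] \<odot> p) w = p w"
      by (cases w) (auto simp: pmul_Nil pmul_Cons fpoly_apply, auto simp: mono_def)
  qed
  show "p \<odot> mono [] = p"
  proof
    fix w show "(p \<odot> mono []) w = p w"
    proof (induction w arbitrary: p)
      case (Cons x w)
      have "(p \<odot> mono []) (x # w) = ((\<lambda>v. p (x # v)) \<odot> mono []) w"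
        by (simp add: pmul_Cons) (simp add: mono_def)
      then show ?case by (simp add: Cons.IH)
    qed (simp add: pmul_Nil, simp add: mono_def)
  qed
qed

lemma mono_append: "mono (u @ v) = mono u \<odot> mono v"
proof (induction u)
  case (Cons x u)
  have "mono (x # u @ v) w = (mono (x # u) \<odot> mono v) w" for w
  proof (cases w)
    case (Cons y w')
    have *: "(\<lambda>w. mono (x # u) (y # w)) = (if x = y then mono u else 0)"
      by (auto simp: mono_def fpoly_apply fun_eq_iff)
    have "(mono (x # u) \<odot> mono v) w = (if x = y then mono (u @ v) w' else 0)"
      unfolding Cons pmul_Cons * using Cons.IH by (auto simp: mono_def fpoly_apply)
    then show ?thesis by (auto simp: mono_def Cons)
  qed (auto simp: pmul_Nil, auto simp: mono_def)
  then show ?case by auto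
qed simp

lemma mono_Cons: "mono (x # w) = var x \<odot> mono w"
  using mono_append[of "[x]" w] by (simp add: var_def)

section \<open>Finitely supported elements\<close>

lemma fin_supp_0 [simp, intro]: "fin_supp 0"
  by (simp add: fin_supp_def fpoly_apply)

lemma fin_supp_add [simp, intro]: "fin_supp p \<Longrightarrow> fin_supp q \<Longrightarrow> fin_supp (p + q)"
  unfolding fin_supp_def by (rule finite_subset[of _ "{w. p w \<noteq> 0} \<union> {w. q w \<noteq> 0}"]) (auto simp: fpoly_apply)

lemma fin_supp_sc [simp, intro]: "fin_supp p \<Longrightarrow> fin_supp (sc c p)"
  unfolding fin_supp_def by (rule finite_subset[of _ "{w. p w \<noteq> 0}"]) (auto simp: sc_def)

lemma fin_supp_minus [simp, intro]: "fin_supp p \<Longrightarrow> fin_supp (- p)"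
  by (simp add: fin_supp_def fpoly_apply)

lemma fin_supp_diff [simp, intro]: "fin_supp p \<Longrightarrow> fin_supp q \<Longrightarrow> fin_supp (p - q)"
  unfolding fin_supp_def by (rule finite_subset[of _ "{w. p w \<noteq> 0} \<union> {w. q w \<noteq> 0}"]) (auto simp: fpoly_apply)

lemma fin_supp_sum [intro]: "(\<And>i. i \<in> A \<Longrightarrow> fin_supp (f i)) \<Longrightarrow> fin_supp (\<Sum>i\<in>A. f i)"
  by (induction A rule: infinite_finite_induct) auto

lemma fin_supp_mono [simp, intro]: "fin_supp (mono w)"
  by (simp add: fin_supp_def mono_def)

lemma fin_supp_var [simp, intro]: "fin_supp (var x)"
  by (simp add: var_def)

lemma fin_supp_pmul [simp, intro]:
  assumes "fin_supp p" "fin_supp q" shows "fin_supp (p \<odot> q)"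
proof -
  have "{w. (p \<odot> q) w \<noteq> 0} \<subseteq> (\<lambda>(u, v). u @ v) ` ({w. p w \<noteq> 0} \<times> {w. q w \<noteq> 0})"
  proof
    fix w assume "w \<in> {w. (p \<odot> q) w \<noteq> 0}"
    then obtain k where "p (take k w) * q (drop k w) \<noteq> 0"
      unfolding pmul_def by (auto elim!: sum.not_neutral_contains_not_neutral)
    then show "w \<in> (\<lambda>(u, v). u @ v) ` ({w. p w \<noteq> 0} \<times> {w. q w \<noteq> 0})"
      by (intro image_eqI[of _ _ "(take k w, drop k w)"]) auto
  qed
  then show ?thesis
    using assms unfolding fin_supp_def by (meson finite_SigmaI finite_imageI finite_subset)
qed

lemma fin_supp_expand:
  assumes "fin_supp p" shows "p = (\<Sum>w\<in>{w. p w \<noteq> 0}. sc (p w) (mono w))"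
proof
  fix v
  have "(\<Sum>w\<in>{w. p w \<noteq> 0}. sc (p w) (mono w)) v = (\<Sum>w\<in>{w. p w \<noteq> 0}. if v = w then p w else 0)"
    unfolding sum_fpoly_apply by (intro sum.cong) (auto simp: sc_def mono_def)
  then show "p v = (\<Sum>w\<in>{w. p w \<noteq> 0}. sc (p w) (mono w)) v"
    using assms by (simp add: fin_supp_def)
qed

lemma fin_supp_induct [consumes 1, case_names zero mono add]:
  assumes "fin_supp p" and "P 0" and "\<And>c w. P (sc c (mono w))"
    and "\<And>p q. fin_supp p \<Longrightarrow> fin_supp q \<Longrightarrow> P p \<Longrightarrow> P q \<Longrightarrow> P (p + q)"
  shows "P p"
proof -
  have "fin_supp (\<Sum>w\<in>A. sc (p w) (mono w)) \<and> P (\<Sum>w\<in>A. sc (p w) (mono w))" for A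
    by (induction A rule: infinite_finite_induct) (auto intro: assms)
  then show ?thesis using fin_supp_expand[OF assms(1)] by metis
qed

text \<open>Like \<open>dQ\<close>, this sums over the support, and a sum over an infinite set is 0.
  Linearity is therefore available only under \<open>fin_supp\<close>, which explains these
  hypotheses below.\<close>

definition lin_ext :: "(jvar list \<Rightarrow> fpoly) \<Rightarrow> fpoly \<Rightarrow> fpoly" where
  "lin_ext F p = (\<Sum>w\<in>{w. p w \<noteq> 0}. sc (p w) (F w))"

lemma lin_ext_superset:
  assumes "finite A" "{w. p w \<noteq> 0} \<subseteq> A"
  shows "lin_ext F p = (\<Sum>w\<in>A. sc (p w) (F w))"
  unfolding lin_ext_def using assms by (intro sum.mono_neutral_left) auto

lemma lin_ext_0 [simp]: "lin_ext F 0 = 0"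
  by (simp add: lin_ext_def fpoly_apply)

lemma lin_ext_mono [simp]: "lin_ext F (mono w) = F w"
  by (subst lin_ext_superset[of "{w}"]) (auto simp: mono_def)

lemma lin_ext_add:
  assumes "fin_supp p" "fin_supp q"
  shows "lin_ext F (p + q) = lin_ext F p + lin_ext F q"
proof -
  let ?A = "{w. p w \<noteq> 0} \<union> {w. q w \<noteq> 0}"
  have "finite ?A" using assms by (simp add: fin_supp_def)
  then have "lin_ext F (p + q) = (\<Sum>w\<in>?A. sc ((p + q) w) (F w))"
    "lin_ext F p = (\<Sum>w\<in>?A. sc (p w) (F w))" "lin_ext F q = (\<Sum>w\<in>?A. sc (q w) (F w))"
    by (intro lin_ext_superset; auto simp: fpoly_apply)+
  then show ?thesis by (simp add: sum.distrib sc_linear fpoly_apply)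
qed

lemma lin_ext_sc:
  assumes "fin_supp p" shows "lin_ext F (sc c p) = sc c (lin_ext F p)"
proof -
  have "lin_ext F (sc c p) = (\<Sum>w\<in>{w. p w \<noteq> 0}. sc (sc c p w) (F w))"
    using assms by (intro lin_ext_superset) (auto simp: fin_supp_def sc_def)
  then show ?thesis by (simp add: lin_ext_def sc_sum) (simp add: sc_def)
qed

lemma fin_supp_lin_ext:
  assumes "\<And>w. fin_supp (F w)" shows "fin_supp (lin_ext F p)"
  unfolding lin_ext_def using assms by auto

section \<open>Odd derivations\<close>

definition wsgn :: "jvar list \<Rightarrow> complex" where
  "wsgn w = prod_list (map psgn w)"

text \<open>The parity automorphism. It supplies the sign of the graded Leibniz rule for elements
  that need not be homogeneous.\<close>

definition grading :: "fpoly \<Rightarrow> fpoly" where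
  "grading p = (\<lambda>w. wsgn w * p w)"

lemma wsgn_simps [simp]: "wsgn [] = 1" "wsgn (x # w) = psgn x * wsgn w"
  "wsgn (u @ v) = wsgn u * wsgn v"
  by (auto simp: wsgn_def)

lemma psgn_square [simp]: "psgn x * psgn x = 1" "psgn x * (psgn x * c) = c"
  by (auto simp: psgn_def)

lemma wsgn_square [simp]: "wsgn w * wsgn w = 1" "wsgn w * (wsgn w * c) = c"
proof -
  show "wsgn w * wsgn w = 1"
    by (induction w) (auto simp: algebra_simps)
  then show "wsgn w * (wsgn w * c) = c"
    by (simp flip: mult.assoc)
qed

lemma grading_linear:
  "grading (p + q) = grading p + grading q" "grading (p - q) = grading p - grading q"
  "grading (- p) = - grading p" "grading (sc c p) = sc c (grading p)"
  by (auto simp: grading_def sc_def fpoly_apply fun_eq_iff algebra_simps)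

lemma grading_simps [simp]: "grading 0 = 0" "grading (grading p) = p"
  "grading (mono w) = sc (wsgn w) (mono w)" "grading (var x) = sc (psgn x) (var x)"
  by (auto simp: grading_def mono_def var_def sc_def fpoly_apply fun_eq_iff)

lemma grading_pmul: "grading (p \<odot> q) = grading p \<odot> grading q"
proof
  fix w
  have "wsgn (take k w) * wsgn (drop k w) = wsgn w" for k
    by (metis append_take_drop_id wsgn_simps(3))
  then show "grading (p \<odot> q) w = (grading p \<odot> grading q) w"
    unfolding grading_def pmul_def sum_distrib_left
    by (intro sum.cong refl) (metis mult.assoc mult.left_commute)
qed

lemma fin_supp_grading [simp, intro]: "fin_supp p \<Longrightarrow> fin_supp (grading p)"
  unfolding fin_supp_def by (rule finite_subset[of _ "{w. p w \<noteq> 0}"]) (auto simp: grading_def)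

text \<open>The recursion of \<open>dQword\<close> with the action on letters as a parameter, so
  that the differential and the homotopy share one theory.\<close>

fun oder_word :: "(jvar \<Rightarrow> fpoly) \<Rightarrow> jvar list \<Rightarrow> fpoly" where
  "oder_word f [] = 0"
| "oder_word f (x # w) = f x \<odot> mono w + sc (psgn x) (var x \<odot> oder_word f w)"

definition oder :: "(jvar \<Rightarrow> fpoly) \<Rightarrow> fpoly \<Rightarrow> fpoly" where
  "oder f = lin_ext (oder_word f)"

lemma dQ_eq_oder: "dQ m = oder (dQvar m)"
proof -
  have "dQword m w = oder_word (dQvar m) w" for w
    by (induction w) auto
  then show ?thesis
    by (auto simp: dQ_def oder_def lin_ext_def fpoly_apply fun_eq_iff sc_def)
qed

lemma oder_0 [simp]: "oder f 0 = 0"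
  by (simp add: oder_def)

lemma oder_var [simp]: "oder f (var x) = f x"
  by (simp add: oder_def var_def)

lemma oder_add: "fin_supp p \<Longrightarrow> fin_supp q \<Longrightarrow> oder f (p + q) = oder f p + oder f q"
  by (simp add: oder_def lin_ext_add)

lemma oder_sc: "fin_supp p \<Longrightarrow> oder f (sc c p) = sc c (oder f p)"
  by (simp add: oder_def lin_ext_sc)

lemma oder_minus: "fin_supp p \<Longrightarrow> oder f (- p) = - oder f p"
  using oder_sc[of p f "-1"] by (simp add: sc_linear)

lemma oder_diff: "fin_supp p \<Longrightarrow> fin_supp q \<Longrightarrow> oder f (p - q) = oder f p - oder f q"
  using oder_add[of p "- q" f] by (simp add: oder_minus)

lemma oder_sum: "(\<And>i. i \<in> A \<Longrightarrow> fin_supp (g i)) \<Longrightarrow> oder f (\<Sum>i\<in>A. g i) = (\<Sum>i\<in>A. oder f (g i))"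
  by (induction A rule: infinite_finite_induct) (auto simp: oder_add fin_supp_sum)

lemmas oder_linear = oder_add oder_sc oder_minus oder_diff

lemma fin_supp_oder:
  assumes "\<And>x. fin_supp (f x)" shows "fin_supp (oder f p)"
proof -
  have "fin_supp (oder_word f w)" for w
    using assms by (induction w) auto
  then show ?thesis unfolding oder_def by (rule fin_supp_lin_ext)
qed

lemma oder_pmul:
  assumes "fin_supp p" "fin_supp q"
  shows "oder f (p \<odot> q) = oder f p \<odot> q + grading p \<odot> oder f q"
proof -
  have word: "oder_word f (u @ v) = oder_word f u \<odot> mono v + sc (wsgn u) (mono u \<odot> oder_word f v)"
    for u v
    by (induction u) (auto simp: pmul_linear sc_linear pmul_assoc mono_append mono_Cons)
  have right: "oder f (mono u \<odot> q) = oder f (mono u) \<odot> q + grading (mono u) \<odot> oder f q" for u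
    using assms(2)
  proof (induction q rule: fin_supp_induct)
    case (mono c v)
    then show ?case
      by (simp add: oder_def pmul_linear lin_ext_sc flip: mono_append)
        (simp add: word pmul_linear sc_linear mult_ac)
  qed (auto simp: oder_linear pmul_linear)
  show ?thesis using assms(1)
  proof (induction p rule: fin_supp_induct)
    case (mono c u)
    show ?case
      using right[of u] assms(2)
      by (simp add: pmul_linear oder_linear sc_linear grading_linear)
  qed (use assms(2) in \<open>auto simp: oder_linear pmul_linear grading_linear\<close>)
qed

text \<open>The second assumption says that \<open>f\<close> reverses the parity of every letter.
  The resulting sign later cancels the mixed terms of an anticommutator.\<close>

lemma grading_oder:
  assumes "fin_supp p" and "\<And>x. grading (f x) = sc (- psgn x) (f x)"
  shows "grading (oder f p) = - oder f (grading p)"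
  using assms(1)
proof (induction p rule: fin_supp_induct)
  case (mono c w)
  have "grading (oder_word f w) = sc (- wsgn w) (oder_word f w)"
    by (induction w)
      (auto simp: assms(2) grading_linear grading_pmul pmul_linear sc_linear mult_ac)
  then show ?case
    by (simp add: grading_linear oder_def lin_ext_sc sc_linear)
qed (auto simp: oder_linear grading_linear)

section \<open>The ideal of relations and linear forms\<close>

abbreviation jet :: "fld \<Rightarrow> idx multiset \<Rightarrow> fpoly" where
  "jet f ms \<equiv> var (JV f ms)"

section \<open>Closure properties of the ideal\<close>

lemma Jideal_sc: "p \<in> Jideal m \<Longrightarrow> sc c p \<in> Jideal m"
proof (induction rule: Jideal.induct)
  case (gen g l r)
  then have "sc c l \<odot> g \<odot> r \<in> Jideal m" by (intro Jideal.gen) auto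
  then show ?case by (simp add: pmul_linear)
qed (auto simp: sc_linear intro: Jideal.intros)

lemma Jideal_minus: "p \<in> Jideal m \<Longrightarrow> - p \<in> Jideal m"
  using Jideal_sc[of p m "-1"] by (simp add: sc_linear)

lemma Jideal_diff: "p \<in> Jideal m \<Longrightarrow> q \<in> Jideal m \<Longrightarrow> p - q \<in> Jideal m"
  using Jideal.add[OF _ Jideal_minus, of p m q] by simp

lemma Jideal_sum: "(\<And>i. i \<in> A \<Longrightarrow> f i \<in> Jideal m) \<Longrightarrow> (\<Sum>i\<in>A. f i) \<in> Jideal m"
  by (induction A rule: infinite_finite_induct) (auto intro: Jideal.intros)

lemma Jideal_pmul_left: "p \<in> Jideal m \<Longrightarrow> fin_supp l \<Longrightarrow> l \<odot> p \<in> Jideal m"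
proof (induction rule: Jideal.induct)
  case (gen g l' r)
  then have "(l \<odot> l') \<odot> g \<odot> r \<in> Jideal m" by (intro Jideal.gen) auto
  then show ?case by (simp add: pmul_assoc)
qed (auto simp: pmul_linear intro: Jideal.intros)

lemma Jideal_pmul_right: "p \<in> Jideal m \<Longrightarrow> fin_supp r \<Longrightarrow> p \<odot> r \<in> Jideal m"
proof (induction rule: Jideal.induct)
  case (gen g l r')
  then have "l \<odot> g \<odot> (r' \<odot> r) \<in> Jideal m" by (intro Jideal.gen) auto
  then show ?case by (simp add: pmul_assoc)
qed (auto simp: pmul_linear intro: Jideal.intros)

lemma rels_Jideal: "g \<in> rels m \<Longrightarrow> g \<in> Jideal m"
  using Jideal.gen[of g m "mono []" "mono []"] by simp

lemmas Jideal_closed = Jideal.zero Jideal.add Jideal_diff Jideal_minus Jideal_sc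
  Jideal_pmul_left Jideal_pmul_right

lemma fin_supp_Jideal: "p \<in> Jideal m \<Longrightarrow> fin_supp p"
  by (induction rule: Jideal.induct) (auto simp: rels_def intro!: fin_supp_pmul fin_supp_add fin_supp_sum)

text \<open>The derivations used here send letters to linear forms of the opposite parity. On such
  forms \<open>D\<close>, a derivation on all words, agrees with \<open>Dlin\<close>, which sees
  only one-letter words; iterated derivatives then merely add multisets.\<close>

inductive_set linform :: "bool \<Rightarrow> fpoly set" for b :: bool where
  zero: "0 \<in> linform b"
| var: "is_odd x = b \<Longrightarrow> var x \<in> linform b"
| add: "p \<in> linform b \<Longrightarrow> q \<in> linform b \<Longrightarrow> p + q \<in> linform b"
| sc: "p \<in> linform b \<Longrightarrow> sc c p \<in> linform b"

lemma linform_minus: "p \<in> linform b \<Longrightarrow> - p \<in> linform b"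
  using linform.sc[of p b "-1"] by (simp add: sc_linear)

lemma linform_diff: "p \<in> linform b \<Longrightarrow> q \<in> linform b \<Longrightarrow> p - q \<in> linform b"
  using linform.add[OF _ linform_minus, of p b q] by simp

lemma linform_sum: "(\<And>i. i \<in> A \<Longrightarrow> f i \<in> linform b) \<Longrightarrow> (\<Sum>i\<in>A. f i) \<in> linform b"
  by (induction A rule: infinite_finite_induct) (auto intro: linform.intros)

lemmas linform_closed = linform.intros linform_minus linform_diff linform_sum

lemma fin_supp_linform: "p \<in> linform b \<Longrightarrow> fin_supp p"
  by (induction rule: linform.induct) auto

lemma grading_linform: "p \<in> linform b \<Longrightarrow> grading p = (if b then - p else p)"
  by (induction rule: linform.induct)
    (auto simp: grading_linear psgn_def sc_linear split: if_splits)

lemma Dlin_linear: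
  "Dlin ms 0 = 0" "Dlin ms (p + q) = Dlin ms p + Dlin ms q" "Dlin ms (- p) = - Dlin ms p"
  "Dlin ms (p - q) = Dlin ms p - Dlin ms q" "Dlin ms (sc c p) = sc c (Dlin ms p)"
  by (auto simp: Dlin_def sc_def fpoly_apply fun_eq_iff split: list.split jvar.split)

lemma Dlin_sum: "Dlin ms (\<Sum>i\<in>A. f i) = (\<Sum>i\<in>A. Dlin ms (f i))"
  by (induction A rule: infinite_finite_induct) (auto simp: Dlin_linear)

lemma Dlin_jet: "Dlin ms (jet f ns) = jet f (ms + ns)"
proof -
  have "ms \<subseteq># ks \<Longrightarrow> ks - ms = ns \<longleftrightarrow> ks = ms + ns" for ks
    by (metis add_diff_cancel_left' subset_mset.add_diff_inverse)
  then show ?thesis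
    by (auto simp: Dlin_def var_def mono_def fun_eq_iff split: list.split jvar.split)
qed

lemma Dlin_linform: "p \<in> linform b \<Longrightarrow> Dlin ms p \<in> linform b"
proof (induction rule: linform.induct)
  case (var x)
  then show ?case by (cases x) (auto simp: Dlin_jet intro: linform.intros)
qed (auto simp: Dlin_linear intro: linform.intros)

lemma Dlin_Dlin: "p \<in> linform b \<Longrightarrow> Dlin ms (Dlin ns p) = Dlin (ms + ns) p"
proof (induction rule: linform.induct)
  case (var x)
  then show ?case by (cases x) (auto simp: Dlin_jet add_ac)
qed (auto simp: Dlin_linear)

lemma Dlin_empty: "p \<in> linform b \<Longrightarrow> Dlin {#} p = p"
proof (induction rule: linform.induct)
  case (var x)
  then show ?case by (cases x) (auto simp: Dlin_jet)
qed (auto simp: Dlin_linear)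

lemma D_linear: "D a 0 = 0" "D a (p + q) = D a p + D a q" "D a (sc c p) = sc c (D a p)"
  by (auto simp: D_def sc_def fpoly_apply fun_eq_iff sum.distrib[symmetric] sum_distrib_left
      intro!: sum.cong sum.neutral)

lemma D_jet: "D a (jet f ns) = jet f (add_mset a ns)"
proof
  fix w
  consider "w = []" | g ks where "w = [JV g ks]" | x y v where "w = x # y # v"
    by (metis jvar.exhaust neq_Nil_conv)
  then show "D a (jet f ns) w = jet f (add_mset a ns) w"
  proof cases
    case 2
    then show ?thesis by (auto simp: D_def var_def mono_def if_distrib cong: if_cong)
  next
    case 3
    have "mono [JV f ns] (w[i := z]) = 0" for i z
      using 3 by (metis mono_def length_Cons length_list_update list.size(3) nat.distinct(1) nat.inject)
    then have "D a (jet f ns) w = 0"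
      unfolding D_def var_def by (intro sum.neutral) (auto simp del: list_update.simps)
    then show ?thesis using 3 by (simp add: var_def mono_def)
  qed (auto simp: D_def var_def mono_def)
qed

lemma D_linform: "p \<in> linform b \<Longrightarrow> D a p = Dlin {#a#} p"
proof (induction rule: linform.induct)
  case (var x)
  then show ?case by (cases x) (auto simp: Dlin_jet D_jet)
qed (auto simp: Dlin_linear D_linear)

lemma Dlist_linform: "p \<in> linform b \<Longrightarrow> Dlist ls p = Dlin (mset ls) p"
proof (induction ls)
  case (Cons a ls)
  then show ?case
    by (simp add: Dlist_def D_linform[OF Dlin_linform] Dlin_Dlin)
qed (auto simp: Dlist_def Dlin_empty)

text \<open>\<open>rels\<close> states commutation for two letters only; a derivation replaces one
  of them by a linear form.\<close>

lemma linform_supercommute: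
  assumes "p \<in> linform b"
  shows "p \<odot> var y - sc (if b \<and> is_odd y then -1 else 1) (var y \<odot> p) \<in> Jideal m"
  using assms
proof (induction rule: linform.induct)
  case (var x)
  then show ?case by (intro rels_Jideal) (auto simp: rels_def)
next
  case (add p q)
  from Jideal.add[OF add.IH] show ?case by (simp add: pmul_linear sc_linear add_diff_add)
next
  case (sc p c)
  from Jideal_sc[OF sc.IH, of c] show ?case by (simp add: pmul_linear sc_linear mult_ac)
qed (simp add: Jideal.zero)

lemma linform_Klein_Gordon:
  assumes "p \<in> linform b"
  shows "(\<Sum>r\<in>UNIV. sc (eta r r) (Dlin (ms + {#r, r#}) p)) + sc (of_real (m\<^sup>2)) (Dlin ms p)
    \<in> Jideal m"
  using assms
proof (induction rule: linform.induct)
  case (var x)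
  obtain f ns where x: "x = JV f ns" by (cases x)
  have "(\<Sum>r\<in>UNIV. sc (eta r r) (jet f (ms + ns + {#r, r#}))) + sc (of_real (m\<^sup>2)) (jet f (ms + ns))
    \<in> Jideal m"
    by (intro rels_Jideal) (auto simp: rels_def)
  then show ?case by (simp add: x Dlin_jet add_ac)
next
  case (add p q)
  from Jideal.add[OF add.IH] show ?case
    by (simp add: Dlin_linear sc_linear sum.distrib add_ac)
next
  case (sc p c)
  from Jideal_sc[OF sc.IH, of c] show ?case
    by (simp add: Dlin_linear sc_linear sc_sum mult_ac)
qed (simp add: Jideal.zero Dlin_linear)

text \<open>Each relation is homogeneous in parity, so the ideal is stable under the automorphism
  that the Leibniz rule applies to left factors.\<close>

lemma grading_rels:
  assumes "g \<in> rels m" shows "\<exists>c. grading g = sc c g"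
  using assms unfolding rels_def
proof (elim UnE CollectE exE conjE)
  fix x y assume "g = var x \<odot> var y - sc (if is_odd x \<and> is_odd y then -1 else 1) (var y \<odot> var x)"
  then have "grading g = sc (psgn x * psgn y) g"
    by (simp add: grading_linear grading_pmul pmul_linear sc_linear mult_ac)
  then show ?thesis ..
next
  fix f ms assume g: "g = (\<Sum>r\<in>UNIV. sc (eta r r) (jet f (ms + {#r, r#})))
    + sc (of_real (m\<^sup>2)) (jet f ms)"
  have "g \<in> linform (is_odd_fld f)"
    unfolding g by (intro linform_closed) auto
  then have "grading g = sc (if is_odd_fld f then - 1 else 1) g"
    by (simp add: grading_linform sc_linear)
  then show ?thesis ..
next
  fix a b ms assume "g = jet (Hf a b) ms - jet (Hf b a) ms"
  then have "grading g = sc 1 g" by (simp add: grading_linear psgn_def)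
  then show ?thesis ..
qed

lemma grading_Jideal: "p \<in> Jideal m \<Longrightarrow> grading p \<in> Jideal m"
proof (induction rule: Jideal.induct)
  case (gen g l r)
  obtain c where "grading g = sc c g" using grading_rels[OF gen(1)] by blast
  moreover have "sc c (grading l \<odot> g \<odot> grading r) \<in> Jideal m"
    using gen by (intro Jideal_sc Jideal.gen) auto
  ultimately show ?case by (simp add: grading_pmul pmul_linear)
qed (auto simp: grading_linear intro: Jideal.intros)

section \<open>Odd derivations commuting with the formal derivatives\<close>

text \<open>Values are prescribed on undifferentiated fields and carried to jets by
  \<open>Dlin\<close>, which builds in the commutation with formal derivatives.\<close>

definition jder :: "(fld \<Rightarrow> fpoly) \<Rightarrow> fpoly \<Rightarrow> fpoly" where
  "jder f = oder (\<lambda>x. case x of JV g ms \<Rightarrow> Dlin ms (f g))"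

text \<open>The conditions under which such a derivation descends to the quotient: linear forms of
  reversed parity respect graded commutativity and Klein-Gordon, and \<open>field_sym\<close>
  respects the symmetry of h.\<close>

locale odd_field_map =
  fixes f :: "fld \<Rightarrow> fpoly"
  assumes linform_field: "f g \<in> linform (\<not> is_odd_fld g)"
    and field_sym: "f (Hf a b) = f (Hf b a)"
begin

lemma jder_jet: "jder f (jet g ms) = Dlin ms (f g)"
  by (simp add: jder_def)

lemma fin_supp_jder [simp, intro]: "fin_supp (jder f p)"
  unfolding jder_def
  by (intro fin_supp_oder) (auto split: jvar.split intro: fin_supp_linform[OF Dlin_linform[OF linform_field]])

lemma jder_0 [simp]: "jder f 0 = 0"
  by (simp add: jder_def)

lemma jder_linear:
  "fin_supp p \<Longrightarrow> fin_supp q \<Longrightarrow> jder f (p + q) = jder f p + jder f q"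
  "fin_supp p \<Longrightarrow> jder f (sc c p) = sc c (jder f p)"
  "fin_supp p \<Longrightarrow> jder f (- p) = - jder f p"
  "fin_supp p \<Longrightarrow> fin_supp q \<Longrightarrow> jder f (p - q) = jder f p - jder f q"
  by (simp_all add: jder_def oder_linear)

lemma jder_sum:
  "(\<And>i. i \<in> A \<Longrightarrow> fin_supp (g i)) \<Longrightarrow> jder f (\<Sum>i\<in>A. g i) = (\<Sum>i\<in>A. jder f (g i))"
  by (simp add: jder_def oder_sum)

lemma jder_pmul:
  "fin_supp p \<Longrightarrow> fin_supp q \<Longrightarrow> jder f (p \<odot> q) = jder f p \<odot> q + grading p \<odot> jder f q"
  by (simp add: jder_def oder_pmul)

lemma grading_jder: "fin_supp p \<Longrightarrow> grading (jder f p) = - jder f (grading p)"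
  unfolding jder_def
  by (rule grading_oder)
    (auto split: jvar.split simp: grading_linform[OF Dlin_linform[OF linform_field]] psgn_def sc_linear)

lemma linform_jder: "p \<in> linform b \<Longrightarrow> jder f p \<in> linform (\<not> b)"
proof (induction rule: linform.induct)
  case (var x)
  then show ?case
    by (cases x) (auto simp: jder_jet intro: Dlin_linform[OF linform_field, simplified])
qed (auto simp: jder_linear fin_supp_linform intro: linform.intros)

lemma jder_rels:
  assumes "g \<in> rels m" shows "jder f g \<in> Jideal m"
  using assms unfolding rels_def
proof (elim UnE CollectE exE conjE)
  fix x y assume g: "g = var x \<odot> var y - sc (if is_odd x \<and> is_odd y then -1 else 1) (var y \<odot> var x)"
  let ?x = "jder f (var x)" and ?y = "jder f (var y)"
  have lin: "?x \<in> linform (\<not> is_odd x)" "?y \<in> linform (\<not> is_odd y)"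
    by (auto intro!: linform_jder linform.var)
  \<comment> \<open>By Leibniz the image splits into the relation for \<open>?x\<close> and
    \<open>var y\<close> and a multiple of the relation for \<open>?y\<close> and
    \<open>var x\<close>; the multiple collects the sign of passing \<open>x\<close> and that of
    exchanging the factors.\<close>
  have "(?x \<odot> var y - sc (if \<not> is_odd x \<and> is_odd y then -1 else 1) (var y \<odot> ?x))
    - sc (psgn x * (if \<not> is_odd y \<and> is_odd x then -1 else 1))
       (?y \<odot> var x - sc (if \<not> is_odd y \<and> is_odd x then -1 else 1) (var x \<odot> ?y)) \<in> Jideal m"
    by (intro Jideal_diff Jideal_sc linform_supercommute lin)
  then show ?thesis
    unfolding g
    by (cases "is_odd x"; cases "is_odd y")
      (auto simp: jder_linear jder_pmul pmul_linear sc_linear psgn_def algebra_simps)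
next
  fix g' ms assume g: "g = (\<Sum>r\<in>UNIV. sc (eta r r) (jet g' (ms + {#r, r#})))
    + sc (of_real (m\<^sup>2)) (jet g' ms)"
  have "jder f g = (\<Sum>r\<in>UNIV. sc (eta r r) (Dlin (ms + {#r, r#}) (f g')))
    + sc (of_real (m\<^sup>2)) (Dlin ms (f g'))"
    unfolding g by (simp add: jder_linear jder_sum jder_jet fin_supp_sum)
  then show ?thesis using linform_Klein_Gordon[OF linform_field] by simp
next
  fix a b ms assume "g = jet (Hf a b) ms - jet (Hf b a) ms"
  then have "jder f g = 0" by (simp add: jder_linear jder_jet field_sym[of a b])
  then show ?thesis by (simp add: Jideal.zero)
qed

lemma jder_Jideal: "p \<in> Jideal m \<Longrightarrow> jder f p \<in> Jideal m"
proof (induction rule: Jideal.induct)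
  case (add p q)
  then show ?case by (auto simp: jder_linear fin_supp_Jideal intro: Jideal.add)
next
  case (gen g l r)
  have g: "g \<in> Jideal m" "fin_supp g" using gen rels_Jideal fin_supp_Jideal by blast+
  have "jder f (l \<odot> g \<odot> r)
    = (jder f l \<odot> g + grading l \<odot> jder f g) \<odot> r + grading (l \<odot> g) \<odot> jder f r"
    using gen g by (simp add: jder_pmul)
  also have "\<dots> \<in> Jideal m"
    using gen g jder_rels
    by (intro Jideal_closed grading_Jideal) auto
  finally show ?case .
qed (simp add: Jideal.zero)

end

text \<open>The mixed terms cancel because odd derivations anticommute with \<open>grading\<close>.
  With \<open>f = g\<close> this handles the square of \<open>dQ\<close>; with the homotopy it makes
  \<open>N\<close> a derivation.\<close>

lemma anticommutator_pmul:
  assumes "odd_field_map f" "odd_field_map g" "fin_supp p" "fin_supp q"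
  defines "N \<equiv> \<lambda>p. jder f (jder g p) + jder g (jder f p)"
  shows "N (p \<odot> q) = N p \<odot> q + p \<odot> N q"
proof -
  interpret f: odd_field_map f by fact
  interpret g: odd_field_map g by fact
  show ?thesis
    using assms(3,4)
    by (simp add: N_def f.jder_pmul g.jder_pmul f.jder_linear g.jder_linear
        f.grading_jder g.grading_jder pmul_linear algebra_simps)
qed

section \<open>Traceless parts of tensors\<close>

text \<open>Gram-Schmidt by induction on \<open>G\<close>: both \<open>x\<close> and the new vector
  are projected off the earlier ones, then the part of \<open>x'\<close> along \<open>g'\<close> is
  removed. The vectors may be dependent; over the reals a vanishing sum of squares forces
  \<open>g'\<close> to vanish on \<open>A\<close>.\<close>

lemma orthogonal_decomposition:
  fixes g :: "'k \<Rightarrow> 'i \<Rightarrow> real"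
  assumes "finite A" "finite G"
  shows "\<exists>s. \<forall>k\<in>G. (\<Sum>i\<in>A. (x i - (\<Sum>k\<in>G. s k * g k i)) * g k i) = 0"
  using assms(2)
proof (induction G arbitrary: x)
  case (insert k0 G)
  define ip where "ip = (\<lambda>x y. \<Sum>i\<in>A. x i * y i :: real)"
  define lc where "lc = (\<lambda>s i. \<Sum>k\<in>G. s k * g k i)"
  obtain sx where sx: "\<And>k. k \<in> G \<Longrightarrow> ip (\<lambda>i. x i - lc sx i) (g k) = 0"
    using insert.IH[of x] by (auto simp: ip_def lc_def)
  obtain sg where sg: "\<And>k. k \<in> G \<Longrightarrow> ip (\<lambda>i. g k0 i - lc sg i) (g k) = 0"
    using insert.IH[of "g k0"] by (auto simp: ip_def lc_def)
  define x' where "x' = (\<lambda>i. x i - lc sx i)"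
  define g' where "g' = (\<lambda>i. g k0 i - lc sg i)"
  have ip_lin: "ip (\<lambda>i. u i - c * v i) w = ip u w - c * ip v w" for u v w c
    by (simp add: ip_def sum_subtractf sum_distrib_left algebra_simps)
  have ip_lc: "ip u (lc s) = 0" if "\<And>k. k \<in> G \<Longrightarrow> ip u (g k) = 0" for u s
  proof -
    have "ip u (lc s) = (\<Sum>k\<in>G. s k * ip u (g k))"
      unfolding ip_def lc_def sum_distrib_left by (subst sum.swap) (simp add: mult_ac)
    then show ?thesis using that by simp
  qed
  \<comment> \<open>If \<open>g'\<close> vanishes on \<open>A\<close>, division by zero makes
    \<open>c\<close> zero, and nothing has to be removed.\<close>
  define c where "c = ip x' g' / ip g' g'"
  have "ip (\<lambda>i. x' i - c * g' i) g' = 0"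
  proof (cases "ip g' g' = 0")
    case True
    then have "\<forall>i\<in>A. g' i = 0"
      unfolding ip_def using assms(1) by (subst (asm) sum_nonneg_eq_0_iff) auto
    then show ?thesis by (simp add: ip_def)
  next
    case False
    then show ?thesis by (subst ip_lin) (simp add: c_def)
  qed
  moreover have orth: "ip (\<lambda>i. x' i - c * g' i) (g k) = 0" if "k \<in> G" for k
    using sx[OF that] sg[OF that] by (simp add: ip_lin x'_def g'_def)
  moreover have "ip u (g k0) = ip u g' + ip u (lc sg)" for u
    by (simp add: ip_def g'_def sum.distrib[symmetric] algebra_simps)
  ultimately have orth0: "ip (\<lambda>i. x' i - c * g' i) (g k0) = 0"
    using ip_lc by simp
  define s where "s = (\<lambda>k. if k = k0 then c else sx k - c * sg k)"
  have "x' i - c * g' i = x i - (\<Sum>k\<in>insert k0 G. s k * g k i)" for i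
  proof -
    have "(\<Sum>k\<in>G. s k * g k i) = (\<Sum>k\<in>G. (sx k - c * sg k) * g k i)"
      using insert.hyps by (intro sum.cong) (auto simp: s_def)
    also have "\<dots> = lc sx i - c * lc sg i"
      by (simp add: lc_def sum_subtractf sum_distrib_left algebra_simps)
    finally have "(\<Sum>k\<in>insert k0 G. s k * g k i) = c * g k0 i + (lc sx i - c * lc sg i)"
      using insert.hyps by (simp add: s_def)
    then show ?thesis by (simp add: x'_def g'_def algebra_simps)
  qed
  then have "\<forall>k\<in>insert k0 G. ip (\<lambda>i. x i - (\<Sum>k\<in>insert k0 G. s k * g k i)) (g k) = 0"
    using orth orth0 by simp
  then show ?case unfolding ip_def by blast
qed simp

definition eta_real :: "idx \<Rightarrow> idx \<Rightarrow> real" where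
  "eta_real a b = (if a = b then (if a = I0 then 1 else -1) else 0)"

lemma eta_eq_eta_real: "eta a b = of_real (eta_real a b)"
  by (simp add: eta_def eta_real_def)

text \<open>As a vector in \<open>i\<close> this lists the coefficients of the trace over slots
  \<open>a\<close> and \<open>b\<close> at \<open>l\<close>. Since the metric is its own inverse, it
  is also the metric in these slots times Kronecker deltas in the others.\<close>

definition metric_tensor :: "nat \<Rightarrow> nat \<Rightarrow> idx list \<Rightarrow> idx list \<Rightarrow> real" where
  "metric_tensor a b l i = (\<Sum>r\<in>UNIV. if i = l[a := r, b := r] then eta_real r r else 0)"

definition trace :: "nat \<Rightarrow> nat \<Rightarrow> (idx list \<Rightarrow> fpoly) \<Rightarrow> idx list \<Rightarrow> fpoly" where
  "trace a b T i = (\<Sum>r\<in>UNIV. sc (eta r r) (T (i[a := r, b := r])))"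

lemma finite_index_lists [simp]: "finite {i :: idx list. length i = k}"
  using finite_lists_length_eq[of "UNIV :: idx set" k] finite_UNIV_idx by simp

lemma remove2_eq_iff:
  assumes "length i = k" "length l = k" "a < b" "b < k"
  shows "remove2 a b i = remove2 a b l \<longleftrightarrow> (\<forall>j<k. j \<noteq> a \<longrightarrow> j \<noteq> b \<longrightarrow> i ! j = l ! j)"
proof -
  have "remove2 a b i = map ((!) i) (filter (\<lambda>j. j \<noteq> a \<and> j \<noteq> b) [0..<length i])" for i
  proof -
    have "concat (map (\<lambda>j. if P j then [i ! j] else []) xs) = map ((!) i) (filter P xs)" for P xs
      by (induction xs) auto
    then show ?thesis by (simp add: remove2_def)
  qed
  then show ?thesis using assms by (auto simp: map_eq_conv)
qed

lemma metric_tensor_eq: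
  assumes "length i = k" "length l = k" "a < b" "b < k"
  shows "metric_tensor a b l i =
    (if remove2 a b i = remove2 a b l then eta_real (i ! a) (i ! b) else 0)"
proof -
  have "i = l[a := r, b := r] \<longleftrightarrow>
      remove2 a b i = remove2 a b l \<and> i ! a = r \<and> i ! b = r" for r
    using assms by (auto simp: remove2_eq_iff[OF assms] list_eq_iff_nth_eq[of i "l[a := r, b := r]"]
        nth_list_update)
  then have "metric_tensor a b l i = (\<Sum>r\<in>UNIV. if r = i ! a then
      (if remove2 a b i = remove2 a b l \<and> i ! b = i ! a then eta_real r r else 0) else 0)"
    unfolding metric_tensor_def by (intro sum.cong) auto
  then show ?thesis by (simp add: finite_UNIV_idx) (auto simp: eta_real_def)
qed

lemma sum_metric_tensor:
  assumes "length l = k"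
  shows "(\<Sum>i | length i = k. sc (of_real (metric_tensor a b l i)) (T i)) = trace a b T l"
proof -
  have "(\<Sum>i | length i = k. sc (of_real (metric_tensor a b l i)) (T i))
    = (\<Sum>r\<in>UNIV. \<Sum>i | length i = k. if i = l[a := r, b := r] then sc (eta r r) (T i) else 0)"
    unfolding metric_tensor_def of_real_sum sum_sc[symmetric]
    by (subst sum.swap) (auto intro!: sum.cong simp: eta_eq_eta_real)
  also have "\<dots> = (\<Sum>r\<in>UNIV. sc (eta r r) (T (l[a := r, b := r])))"
    using assms by (intro sum.cong) (auto simp: sum.delta)
  finally show ?thesis by (simp add: trace_def)
qed

text \<open>Tracelessness is Euclidean orthogonality to the metric terms, since the metric has the same
  components with upper and lower indices.  The orthogonal projection is symmetric, so that it
  expresses the difference of a tensor and its traceless part by traces.\<close>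

lemma traceless_part_exists:
  fixes T :: "idx list \<Rightarrow> fpoly"
  shows "\<exists>T0 P s. is_traceless_part k T T0 \<and>
    (\<forall>i. T0 i = (\<Sum>j | length j = k. sc (P i j) (T j))) \<and>
    (\<forall>i. length i = k \<longrightarrow> T i = T0 i + (\<Sum>(a, b)\<in>{(a, b). a < b \<and> b < k}.
      \<Sum>l | length l = k. sc (s i a b l) (trace a b T l)))"
proof -
  define A where "A = {i :: idx list. length i = k}"
  define M where "M = {(a, b). a < b \<and> b < k}"
  have "M \<subseteq> {..<k} \<times> {..<k}" by (auto simp: M_def)
  then have fin: "finite A" "finite M" by (auto simp: A_def finite_subset)
  define g where "g = (\<lambda>((a, b), l). metric_tensor a b l)"
  \<comment> \<open>Projecting the unit vectors gives a real matrix \<open>c\<close> that does not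
    depend on \<open>T\<close>, so a real inner product suffices although \<open>T\<close> takes
    values in polynomials.\<close>
  define \<delta> where "\<delta> = (\<lambda>j i :: idx list. if i = j then 1 else 0 :: real)"
  have "\<forall>j. \<exists>s. \<forall>k\<in>M \<times> A. (\<Sum>i\<in>A. (\<delta> j i - (\<Sum>k\<in>M \<times> A. s k * g k i)) * g k i) = 0"
    by (intro allI orthogonal_decomposition finite_cartesian_product fin)
  then obtain s where
    s: "\<And>j k. k \<in> M \<times> A \<Longrightarrow> (\<Sum>i\<in>A. (\<delta> j i - (\<Sum>k\<in>M \<times> A. s j k * g k i)) * g k i) = 0"
    by (subst (asm) choice_iff) blast
  define c where "c = (\<lambda>j i. \<delta> j i - (\<Sum>k\<in>M \<times> A. s j k * g k i))"
  have orth: "(\<Sum>i\<in>A. c j i * g k i) = 0" if "k \<in> M \<times> A" for j k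
    using s[OF that] by (simp add: c_def)
  \<comment> \<open>Row \<open>c j\<close> is orthogonal to all metric terms and row
    \<open>c i\<close> differs from a unit vector by such terms, so the entry is an inner product of
    two rows. This makes \<open>c\<close> symmetric.\<close>
  have c_ip: "c j i = (\<Sum>i'\<in>A. c j i' * c i i')" if "i \<in> A" for j i
  proof -
    have "(\<Sum>i'\<in>A. c j i' * (\<Sum>k\<in>M \<times> A. s i k * g k i'))
      = (\<Sum>k\<in>M \<times> A. s i k * (\<Sum>i'\<in>A. c j i' * g k i'))"
      unfolding sum_distrib_left by (subst sum.swap) (simp add: mult_ac)
    also have "\<dots> = 0" using orth by (intro sum.neutral) auto
    moreover have "(\<Sum>i'\<in>A. c j i' * \<delta> i i') = c j i"
      using that fin by (simp add: \<delta>_def if_distrib cong: if_cong)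
    moreover have "c j i' * c i i' = c j i' * \<delta> i i' - c j i' * (\<Sum>k\<in>M \<times> A. s i k * g k i')" for i'
      by (simp add: fun_cong[OF fun_cong[OF c_def], of i] right_diff_distrib)
    ultimately show ?thesis
      by (simp add: sum_subtractf)
  qed
  have c_sym: "c i j = c j i" if "i \<in> A" "j \<in> A" for i j
    using c_ip[OF that(1), of j] c_ip[OF that(2), of i] by (simp add: mult.commute)
  define T0 where "T0 = (\<lambda>i. \<Sum>j\<in>A. sc (of_real (c j i)) (T j))"
  have delta_sum: "(\<Sum>j\<in>A. sc (of_real (\<delta> i j)) (T j)) = T i" if "i \<in> A" for i
  proof -
    have "(\<Sum>j\<in>A. sc (of_real (\<delta> i j)) (T j)) = (\<Sum>j\<in>A. if j = i then T j else 0)"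
      by (intro sum.cong) (auto simp: \<delta>_def)
    then show ?thesis using that fin by simp
  qed
  have "traceless k T0"
    unfolding traceless_def
  proof (intro allI impI)
    fix l :: "idx list" and a b assume l: "length l = k" "a < b" "b < k"
    have "(\<Sum>r\<in>UNIV. sc (eta r r) (T0 (l[a := r, b := r]))) = trace a b T0 l"
      by (simp add: trace_def)
    also have "\<dots> = (\<Sum>i\<in>A. sc (of_real (metric_tensor a b l i)) (T0 i))"
      using l by (simp add: sum_metric_tensor A_def)
    also have "\<dots> = (\<Sum>j\<in>A. sc (of_real (\<Sum>i\<in>A. c j i * g ((a, b), l) i)) (T j))"
      unfolding T0_def sc_sum
      by (subst sum.swap) (simp add: sum_sc g_def mult_ac)
    also have "\<dots> = 0"
      using l by (subst orth) (auto simp: M_def A_def)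
    finally show "(\<Sum>r\<in>UNIV. sc (eta r r) (T0 (l[a := r, b := r]))) = 0" .
  qed
  have diff: "T i - T0 i = (\<Sum>j\<in>A. \<Sum>k\<in>M \<times> A. sc (of_real (s j k * g k i)) (T j))" if "i \<in> A" for i
  proof -
    have "T i - T0 i = (\<Sum>j\<in>A. sc (of_real (\<delta> i j - c j i)) (T j))"
      using delta_sum[OF that] by (simp add: T0_def sum_subtractf sc_linear)
    also have "\<dots> = (\<Sum>j\<in>A. sc (of_real (\<Sum>k\<in>M \<times> A. s j k * g k i)) (T j))"
      by (intro sum.cong refl) (simp add: c_def \<delta>_def eq_commute)
    finally show ?thesis by (simp add: sum_sc)
  qed
  have "trace_span k (\<lambda>i. T i - T0 i)"
    unfolding trace_span_def
  proof (intro exI allI impI)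
    fix i :: "idx list" assume i: "length i = k"
    \<comment> \<open>The coefficients belong to full index lists, whereas \<open>trace_span\<close>
      wants a tensor in the remaining indices; all \<open>l\<close> with the same remaining entries
      are collected.\<close>
    let ?S = "\<lambda>a b x. \<Sum>l\<in>A. \<Sum>j\<in>A. sc (if x = remove2 a b l then of_real (s j ((a, b), l)) else 0) (T j)"
    have "T i - T0 i = (\<Sum>(a, b)\<in>M. \<Sum>l\<in>A. \<Sum>j\<in>A. sc (of_real (s j ((a, b), l) * g ((a, b), l) i)) (T j))"
    proof -
      have "T i - T0 i = (\<Sum>k\<in>M \<times> A. \<Sum>j\<in>A. sc (of_real (s j k * g k i)) (T j))"
        using i by (subst diff) (auto simp: A_def intro: sum.swap)
      then show ?thesis by (simp add: sum.cartesian_product' split_def)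
    qed
    also have "\<dots> = (\<Sum>(a, b)\<in>M. sc (eta (i ! a) (i ! b)) (?S a b (remove2 a b i)))"
    proof (intro sum.cong refl, clarify)
      fix a b assume "(a, b) \<in> M"
      then show "(\<Sum>l\<in>A. \<Sum>j\<in>A. sc (of_real (s j ((a, b), l) * g ((a, b), l) i)) (T j))
          = sc (eta (i ! a) (i ! b)) (?S a b (remove2 a b i))"
        unfolding sc_sum using i
        by (intro sum.cong refl)
          (auto simp: A_def M_def g_def metric_tensor_eq eta_eq_eta_real mult_ac)
    qed
    finally show "T i - T0 i = (\<Sum>(a, b)\<in>{(a, b). a < b \<and> b < k}.
        sc (eta (i ! a) (i ! b)) (?S a b (remove2 a b i)))"
      by (simp add: M_def)
  qed
  moreover have "T i = T0 i + (\<Sum>(a, b)\<in>M. \<Sum>l\<in>A. sc (of_real (s i ((a, b), l))) (trace a b T l))"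
    if i: "i \<in> A" for i
  proof -
    \<comment> \<open>Exchanging the indices of \<open>c\<close> by symmetry turns the metric terms
      into traces of \<open>T\<close> itself.\<close>
    have "T i - T0 i = (\<Sum>j\<in>A. sc (of_real (\<delta> i j - c i j)) (T j))"
      using delta_sum[OF i] c_sym[OF i] by (simp add: T0_def sum_subtractf sc_linear)
    also have "\<dots> = (\<Sum>j\<in>A. \<Sum>k\<in>M \<times> A. sc (of_real (s i k * g k j)) (T j))"
      by (simp add: c_def sum_sc)
    also have "\<dots> = (\<Sum>k\<in>M \<times> A. sc (of_real (s i k)) (\<Sum>j\<in>A. sc (of_real (g k j)) (T j)))"
      by (subst sum.swap) (simp add: sc_sum)
    also have "\<dots> = (\<Sum>(a, b)\<in>M. \<Sum>l\<in>A. sc (of_real (s i ((a, b), l))) (trace a b T l))"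
      unfolding sum.cartesian_product' split_def
      by (intro sum.cong refl) (simp add: g_def split_def A_def sum_metric_tensor)
    finally show ?thesis by (simp add: algebra_simps)
  qed
  ultimately show ?thesis
    using \<open>traceless k T0\<close>
    by (intro exI[of _ T0] exI[of _ "\<lambda>i j. of_real (c j i)"]
        exI[of _ "\<lambda>i a b l. of_real (s i ((a, b), l))"])
      (auto simp: is_traceless_part_def T0_def A_def M_def)
qed

section \<open>The contracting homotopy\<close>

definition div_h :: "idx \<Rightarrow> idx multiset \<Rightarrow> fpoly" where
  "div_h a ms = (\<Sum>r\<in>UNIV. sc (eta r r) (jet (Hf a r) (add_mset r ms)))"

lemma eta_contract: "(\<Sum>r\<in>UNIV. sc (eta r r * eta a r) (F r)) = F a"
  by (cases a) (simp_all add: sum_idx eta_def)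

lemma i_squared: "\<i> * (\<i> * z) = - z"
  by (simp flip: mult.assoc)

lemma eta_sym: "eta a b = eta b a"
  by (simp add: eta_def)

definition homotopy_field :: "real \<Rightarrow> fld \<Rightarrow> fpoly" where
  "homotopy_field m f = (case f of
      Vf a \<Rightarrow> sc (- \<i> / of_real m) (jet (UTf a) {#})
    | Uf a \<Rightarrow> sc (- 2 * \<i> / of_real (m\<^sup>2)) (div_h a {#})
    | _ \<Rightarrow> 0)"

lemma dQf_eq:
  "dQf m (Hf a b) = sc (- \<i> / 2) (jet (Uf b) {#a#} + jet (Uf a) {#b#}
     - sc (eta a b) (\<Sum>r\<in>UNIV. sc (eta r r) (jet (Uf r) {#r#})))"
  "dQf m (Vf a) = sc (- \<i> * of_real m / 2) (jet (Uf a) {#})"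
  "dQf m (Uf a) = 0"
  "dQf m (UTf a) = sc \<i> (div_h a {#} + sc (of_real m) (jet (Vf a) {#}))"
  by (simp_all add: dQf_def fv_def D_jet div_h_def)

lemma linform_div_h: "div_h a ms \<in> linform False"
  unfolding div_h_def by (intro linform_closed) auto

lemma fin_supp_div_h [simp, intro]: "fin_supp (div_h a ms)"
  by (rule fin_supp_linform[OF linform_div_h])

lemma Dlin_div_h: "Dlin ms (div_h a ns) = div_h a (ms + ns)"
  by (simp add: div_h_def Dlin_sum Dlin_linear Dlin_jet)

lemma odd_field_map_dQf: "odd_field_map (dQf m)"
proof
  fix g a b
  show "dQf m g \<in> linform (\<not> is_odd_fld g)"
    by (cases g) (auto simp: dQf_eq intro!: linform_closed linform_div_h)
  show "dQf m (Hf a b) = dQf m (Hf b a)"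
    by (simp add: dQf_eq eta_sym[of a b] add.commute)
qed

lemma odd_field_map_homotopy: "odd_field_map (homotopy_field m)"
proof
  fix g a b
  show "homotopy_field m g \<in> linform (\<not> is_odd_fld g)"
    by (cases g) (auto simp: homotopy_field_def intro!: linform_closed linform_div_h)
qed (simp add: homotopy_field_def)

lemma dQ_eq_jder: "dQ m = jder (dQf m)"
proof -
  have "dQvar m = (\<lambda>x. case x of JV g ms \<Rightarrow> Dlin ms (dQf m g))"
    by (auto simp: fun_eq_iff split: jvar.split)
  then show ?thesis by (simp add: dQ_eq_oder jder_def)
qed

locale massive =
  fixes m :: real
  assumes mass_pos: "m > 0"
begin

sublocale d: odd_field_map "dQf m"
  rewrites "jder (dQf m) = dQ m"
  by (simp_all add: odd_field_map_dQf dQ_eq_jder)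

sublocale k: odd_field_map "homotopy_field m"
  by (rule odd_field_map_homotopy)

abbreviation K :: "fpoly \<Rightarrow> fpoly" where "K \<equiv> jder (homotopy_field m)"

definition N :: "fpoly \<Rightarrow> fpoly" where "N p = dQ m (K p) + K (dQ m p)"

lemma mass_neq_0 [simp]: "complex_of_real m \<noteq> 0" "m \<noteq> 0"
  using mass_pos by auto

section \<open>The differential and the homotopy on jets\<close>

lemma dQ_jet:
  "dQ m (jet (Hf a b) ms) = sc (- \<i> / 2) (jet (Uf b) (add_mset a ms) + jet (Uf a) (add_mset b ms)
     - sc (eta a b) (\<Sum>r\<in>UNIV. sc (eta r r) (jet (Uf r) (add_mset r ms))))"
  "dQ m (jet (Vf a) ms) = sc (- \<i> * of_real m / 2) (jet (Uf a) ms)"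
  "dQ m (jet (Uf a) ms) = 0"
  "dQ m (jet (UTf a) ms) = sc \<i> (div_h a ms + sc (of_real m) (jet (Vf a) ms))"
  by (simp_all add: d.jder_jet dQf_eq Dlin_linear Dlin_sum Dlin_jet Dlin_div_h)

lemma K_jet:
  "K (jet (Hf a b) ms) = 0" "K (jet (UTf a) ms) = 0"
  "K (jet (Vf a) ms) = sc (- \<i> / of_real m) (jet (UTf a) ms)"
  "K (jet (Uf a) ms) = sc (- 2 * \<i> / of_real (m\<^sup>2)) (div_h a ms)"
  by (simp_all add: k.jder_jet homotopy_field_def Dlin_linear Dlin_jet Dlin_div_h)

lemma K_div_h: "K (div_h a ms) = 0"
  by (simp add: div_h_def k.jder_sum k.jder_linear K_jet)

text \<open>The trace term contracts to a derivative of the divergence of u and cancels the other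
  such term; only the d'Alembertian survives. \<open>N_div_h\<close> and
  \<open>div_phic_exact\<close> rest on the same cancellation.\<close>

lemma dQ_div_h_eq:
  "dQ m (div_h a ms) = sc (- \<i> / 2) (\<Sum>r\<in>UNIV. sc (eta r r) (jet (Uf a) (ms + {#r, r#})))"
proof -
  let ?S = "\<lambda>r. \<Sum>s\<in>UNIV. sc (eta s s) (jet (Uf s) (add_mset s (add_mset r ms)))"
  have "dQ m (div_h a ms) = sc (- \<i> / 2) ((\<Sum>r\<in>UNIV. sc (eta r r) (jet (Uf r) (add_mset a (add_mset r ms))))
     + (\<Sum>r\<in>UNIV. sc (eta r r) (jet (Uf a) (ms + {#r, r#}))) - (\<Sum>r\<in>UNIV. sc (eta r r * eta a r) (?S r)))"
    by (simp add: div_h_def d.jder_sum d.jder_linear dQ_jet sc_linear sc_sum sum.distrib sum_subtractf sum_negf mult_ac)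
  then show ?thesis
    unfolding eta_contract by (simp add: add_mset_commute)
qed

lemma Klein_Gordon_jet:
  "(\<Sum>r\<in>UNIV. sc (eta r r) (jet f (ms + {#r, r#}))) + sc (of_real (m\<^sup>2)) (jet f ms) \<in> Jideal m"
  by (intro rels_Jideal) (auto simp: rels_def)

lemma dQ_div_h: "dQ m (div_h a ms) - sc (\<i> * of_real (m\<^sup>2) / 2) (jet (Uf a) ms) \<in> Jideal m"
proof -
  have "dQ m (div_h a ms) - sc (\<i> * of_real (m\<^sup>2) / 2) (jet (Uf a) ms) = sc (- \<i> / 2)
    ((\<Sum>r\<in>UNIV. sc (eta r r) (jet (Uf a) (ms + {#r, r#}))) + sc (of_real (m\<^sup>2)) (jet (Uf a) ms))"
    by (simp add: dQ_div_h_eq sc_linear)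
  then show ?thesis using Jideal_sc[OF Klein_Gordon_jet] by simp
qed

lemma fin_supp_dQ [simp, intro]: "fin_supp (dQ m p)"
  by (rule d.fin_supp_jder)

text \<open>The square vanishes outright except on ut, where the u-terms from the divergence of h
  and from v cancel by Klein-Gordon.\<close>

lemma dQ_dQ_jet: "dQ m (dQ m (jet f ms)) \<in> Jideal m"
proof (cases f)
  case (UTf a)
  have "dQ m (dQ m (jet f ms)) = sc \<i> (dQ m (div_h a ms) - sc (\<i> * of_real (m\<^sup>2) / 2) (jet (Uf a) ms))"
    by (simp add: UTf dQ_jet d.jder_linear sc_linear power2_eq_square mult_ac i_squared)
  then show ?thesis using Jideal_sc[OF dQ_div_h] by simp
next
  case (Hf a b)
  then show ?thesis
    by (simp add: dQ_jet d.jder_linear d.jder_sum fin_supp_sum Jideal.zero)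
qed (simp_all add: dQ_jet d.jder_linear Jideal.zero)

lemma dQ_dQ:
  assumes "fin_supp p" shows "dQ m (dQ m p) \<in> Jideal m"
  using assms
proof (induction p rule: fin_supp_induct)
  case (mono c w)
  have "dQ m (dQ m (mono w)) \<in> Jideal m"
  proof (induction w)
    case Nil
    have "dQ m (mono []) = 0" by (simp add: dQ_eq_oder oder_def)
    then show ?case by (simp add: Jideal.zero)
  next
    case (Cons x w)
    have x: "dQ m (dQ m (var x)) \<in> Jideal m" by (cases x) (simp add: dQ_dQ_jet)
    \<comment> \<open>With both derivations equal, the anticommutator is twice the square of
      \<open>dQ\<close>; the factor 2 is divided out below.\<close>
    have double: "p + p = sc 2 p" for p :: fpoly
      by (simp add: sc_def fpoly_apply fun_eq_iff)
    have "sc 2 (dQ m (dQ m (mono (x # w)))) = sc 2 (dQ m (dQ m (var x)) \<odot> mono w + var x \<odot> dQ m (dQ m (mono w)))"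
      using anticommutator_pmul[OF odd_field_map_dQf odd_field_map_dQf, of "var x" "mono w" m m]
      by (simp add: mono_Cons pmul_linear sc_linear(1) double del: mult_2 flip: dQ_eq_jder)
    then have "sc (1/2) (sc 2 (dQ m (dQ m (mono (x # w)))))
        = sc (1/2) (sc 2 (dQ m (dQ m (var x)) \<odot> mono w + var x \<odot> dQ m (dQ m (mono w))))"
      by simp
    then show ?case using x Cons.IH by (auto intro: Jideal.add Jideal_pmul_left Jideal_pmul_right)
  qed
  then show ?case by (simp add: d.jder_linear Jideal_sc)
qed (auto simp: d.jder_linear Jideal.zero intro: Jideal.add)

section \<open>The even derivation \<open>N\<close> and its action on jets\<close>

lemma N_linear:
  "fin_supp p \<Longrightarrow> fin_supp q \<Longrightarrow> N (p + q) = N p + N q"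
  "fin_supp p \<Longrightarrow> N (sc c p) = sc c (N p)"
  "fin_supp p \<Longrightarrow> fin_supp q \<Longrightarrow> N (p - q) = N p - N q"
  "fin_supp p \<Longrightarrow> N (- p) = - N p" "N 0 = 0"
  by (simp_all add: N_def d.jder_linear k.jder_linear sc_linear)

lemma N_sum: "(\<And>i. i \<in> A \<Longrightarrow> fin_supp (g i)) \<Longrightarrow> N (\<Sum>i\<in>A. g i) = (\<Sum>i\<in>A. N (g i))"
  by (induction A rule: infinite_finite_induct) (auto simp: N_linear fin_supp_sum)

lemma N_pmul: "fin_supp p \<Longrightarrow> fin_supp q \<Longrightarrow> N (p \<odot> q) = N p \<odot> q + p \<odot> N q"
  using anticommutator_pmul[OF odd_field_map_dQf odd_field_map_homotopy, of p q m m]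
  by (simp add: N_def flip: dQ_eq_jder)

lemma fin_supp_N [simp, intro]: "fin_supp (N p)"
  by (simp add: N_def)

lemma N_Jideal: "p \<in> Jideal m \<Longrightarrow> N p \<in> Jideal m"
  by (simp add: N_def d.jder_Jideal k.jder_Jideal Jideal.add)

text \<open>This is \<open>dQ\<close> of a jet of h with each u replaced by its image under
  \<open>K\<close>; the factor is (-i/2)(-2i/m^2) = -1/m^2.\<close>

definition proj_h :: "idx \<Rightarrow> idx \<Rightarrow> idx multiset \<Rightarrow> fpoly" where
  "proj_h a b ms = sc (- 1 / of_real (m\<^sup>2)) (div_h b (add_mset a ms) + div_h a (add_mset b ms)
     - sc (eta a b) (\<Sum>r\<in>UNIV. sc (eta r r) (div_h r (add_mset r ms))))"

lemma fin_supp_proj_h [simp, intro]: "fin_supp (proj_h a b ms)"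
  by (auto simp: proj_h_def intro!: fin_supp_sc fin_supp_diff fin_supp_add fin_supp_sum)

lemma N_Hf: "N (jet (Hf a b) ms) = proj_h a b ms"
  by (simp add: N_def proj_h_def K_jet dQ_jet k.jder_linear k.jder_sum fin_supp_sum sc_linear sc_sum mult_ac)

lemma N_UTf: "N (jet (UTf a) ms) = jet (UTf a) ms"
  by (simp add: N_def K_jet K_div_h dQ_jet k.jder_linear d.jder_linear sc_linear)

lemma N_Vf: "N (jet (Vf a) ms) = jet (Vf a) ms"
  by (simp add: N_def K_jet dQ_jet k.jder_linear d.jder_linear sc_linear power2_eq_square)

lemma N_Uf: "N (jet (Uf a) ms) - jet (Uf a) ms \<in> Jideal m"
  using Jideal_sc[OF dQ_div_h, of "- 2 * \<i> / of_real (m\<^sup>2)" a ms]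
  by (simp add: N_def K_jet dQ_jet k.jder_linear d.jder_linear sc_linear)

text \<open>Modulo Klein-Gordon, \<open>proj_h\<close> has the same divergence as h. As
  \<open>proj_h\<close> is built from derivatives of such divergences, \<open>N\<close> fixes it
  too, which is the projection property.\<close>

lemma N_div_h: "N (div_h a ms) - div_h a ms \<in> Jideal m"
proof -
  let ?S = "\<lambda>r. \<Sum>s\<in>UNIV. sc (eta s s) (div_h s (add_mset s (add_mset r ms)))"
  have "N (div_h a ms) = sc (- 1 / of_real (m\<^sup>2)) ((\<Sum>r\<in>UNIV. sc (eta r r) (div_h r (add_mset a (add_mset r ms))))
     + (\<Sum>r\<in>UNIV. sc (eta r r) (div_h a (ms + {#r, r#}))) - (\<Sum>r\<in>UNIV. sc (eta r r * eta a r) (?S r)))"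
    by (simp add: div_h_def[of a ms] N_sum N_linear N_Hf proj_h_def sc_linear sc_sum sum.distrib sum_subtractf sum_negf mult_ac)
  also have "\<dots> = sc (- 1 / of_real (m\<^sup>2)) (\<Sum>r\<in>UNIV. sc (eta r r) (div_h a (ms + {#r, r#})))"
    unfolding eta_contract by (simp add: add_mset_commute)
  finally have "N (div_h a ms) - div_h a ms = sc (- 1 / of_real (m\<^sup>2))
      ((\<Sum>r\<in>UNIV. sc (eta r r) (Dlin (ms + {#r, r#}) (div_h a {#}))) + sc (of_real (m\<^sup>2)) (Dlin ms (div_h a {#})))"
    by (simp add: Dlin_div_h sc_linear)
  then show ?thesis using Jideal_sc[OF linform_Klein_Gordon[OF linform_div_h]] by simp
qed

lemma N_proj_h: "N (proj_h a b ms) - proj_h a b ms \<in> Jideal m"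
proof -
  let ?e = "\<lambda>a ms. N (div_h a ms) - div_h a ms"
  have "N (proj_h a b ms) - proj_h a b ms = sc (- 1 / of_real (m\<^sup>2)) (?e b (add_mset a ms) + ?e a (add_mset b ms)
     - sc (eta a b) (\<Sum>r\<in>UNIV. sc (eta r r) (?e r (add_mset r ms))))"
    by (simp add: proj_h_def N_linear N_sum fin_supp_sum sc_linear sc_sum sum_subtractf sum_negf algebra_simps)
  also have "\<dots> \<in> Jideal m"
    by (intro Jideal_sc Jideal_diff Jideal.add Jideal_sum N_div_h)
  finally show ?thesis .
qed

section \<open>Cocycles cohomologous to polynomials in the traceless variables\<close>

text \<open>The cocycle condition belongs to the predicate because closure under products relies on
  it.\<close>

definition reducible :: "fpoly \<Rightarrow> bool" where
  "reducible p \<longleftrightarrow> fin_supp p \<and> dQ m p \<in> Jideal m \<and>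
     (\<exists>b q. fin_supp b \<and> fin_supp q \<and> q \<in> alg_gen (traceless_vars m) \<and> p - dQ m b - q \<in> Jideal m)"

lemma reducible_add:
  assumes "reducible p" "reducible p'" shows "reducible (p + p')"
proof -
  from assms obtain b q b' q' where
    "fin_supp b" "fin_supp q" "q \<in> alg_gen (traceless_vars m)" "p - dQ m b - q \<in> Jideal m"
    "fin_supp b'" "fin_supp q'" "q' \<in> alg_gen (traceless_vars m)" "p' - dQ m b' - q' \<in> Jideal m"
    unfolding reducible_def by blast
  moreover from this have "(p + p') - dQ m (b + b') - (q + q') \<in> Jideal m"
    using Jideal.add[of "p - dQ m b - q" m "p' - dQ m b' - q'"]
    by (simp add: d.jder_linear algebra_simps)
  ultimately show ?thesis
    using assms unfolding reducible_def
    by (intro conjI exI[of _ "b + b'"] exI[of _ "q + q'"])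
      (auto simp: d.jder_linear intro: Jideal.add alg_gen.add)
qed

lemma reducible_sc:
  assumes "reducible p" shows "reducible (sc c p)"
proof -
  from assms obtain b q where
    "fin_supp b" "fin_supp q" "q \<in> alg_gen (traceless_vars m)" "p - dQ m b - q \<in> Jideal m"
    unfolding reducible_def by blast
  moreover from this have "sc c p - dQ m (sc c b) - sc c q \<in> Jideal m"
    using Jideal_sc[of "p - dQ m b - q" m c] by (simp add: d.jder_linear sc_linear)
  ultimately show ?thesis
    using assms unfolding reducible_def
    by (intro conjI exI[of _ "sc c b"] exI[of _ "sc c q"])
      (auto simp: d.jder_linear intro: Jideal_sc alg_gen.smul)
qed

lemma reducible_traceless_var:
  "p \<in> traceless_vars m \<Longrightarrow> fin_supp p \<Longrightarrow> dQ m p \<in> Jideal m \<Longrightarrow> reducible p"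
  unfolding reducible_def
  by (intro conjI exI[of _ 0] exI[of _ p]) (auto intro: alg_gen.base Jideal.zero)

lemma reducible_one: "reducible (mono [])"
proof -
  have "dQ m (mono []) = 0" by (simp add: dQ_eq_oder oder_def)
  then show ?thesis
    unfolding reducible_def
    by (intro conjI exI[of _ 0] exI[of _ "mono []"])
      (auto intro: Jideal.zero alg_gen.one[unfolded pone_def])
qed

lemma reducible_Jideal: "p \<in> Jideal m \<Longrightarrow> reducible p"
  using alg_gen.smul[OF alg_gen.one, of 0] unfolding reducible_def
  by (intro conjI exI[of _ 0]) (auto simp: fin_supp_Jideal d.jder_Jideal)

lemma reducible_dQ: "fin_supp b \<Longrightarrow> reducible (dQ m b)"
  using alg_gen.smul[OF alg_gen.one, of 0] unfolding reducible_def
  by (intro conjI exI[of _ b] exI[of _ 0]) (auto simp: dQ_dQ Jideal.zero)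

lemma reducible_sum: "(\<And>i. i \<in> A \<Longrightarrow> reducible (g i)) \<Longrightarrow> reducible (\<Sum>i\<in>A. g i)"
  by (induction A rule: infinite_finite_induct)
    (auto intro: reducible_add reducible_Jideal Jideal.zero)

lemma reducible_cong: "reducible q \<Longrightarrow> p - q \<in> Jideal m \<Longrightarrow> reducible p"
  using reducible_add[OF _ reducible_Jideal, of q "p - q"] by simp

lemma reducible_pmul:
  assumes "reducible p" "reducible p'" shows "reducible (p \<odot> p')"
proof -
  from assms obtain b q b' q' where
    bq: "fin_supp b" "fin_supp q" "q \<in> alg_gen (traceless_vars m)" "p - dQ m b - q \<in> Jideal m"
    and bq': "fin_supp b'" "fin_supp q'" "q' \<in> alg_gen (traceless_vars m)" "p' - dQ m b' - q' \<in> Jideal m"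
    unfolding reducible_def by blast
  from assms have p: "fin_supp p" "dQ m p \<in> Jideal m" and p': "fin_supp p'" "dQ m p' \<in> Jideal m"
    by (auto simp: reducible_def)
  \<comment> \<open>Modulo the ideal \<open>q\<close> is \<open>p - dQ m b\<close>, hence again a
    cocycle; this allows \<open>dQ\<close> to be moved past \<open>q\<close>.\<close>
  have "dQ m q = dQ m p - dQ m (dQ m b) - dQ m (p - dQ m b - q)"
    using p bq by (simp add: d.jder_linear)
  then have dq: "dQ m q \<in> Jideal m"
    using p bq dQ_dQ d.jder_Jideal by (auto intro!: Jideal_diff)
  \<comment> \<open>First \<open>p\<close> is exchanged for \<open>q\<close> in front of
    \<open>p'\<close>, then \<open>p'\<close> for \<open>q'\<close> behind \<open>q\<close>. The
    Leibniz rule applies \<open>grading\<close> to its left factor, so \<open>grading q\<close>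
    yields \<open>q \<odot> dQ m b'\<close> without a sign.\<close>
  let ?b = "b \<odot> p' + grading q \<odot> b'"
  have "dQ m ?b = dQ m b \<odot> p' + grading b \<odot> dQ m p' + (dQ m (grading q) \<odot> b' + q \<odot> dQ m b')"
    using bq bq' p' by (simp add: d.jder_linear d.jder_pmul)
  then have "p \<odot> p' - dQ m ?b - q \<odot> q' = (p - dQ m b - q) \<odot> p' + q \<odot> (p' - dQ m b' - q')
    - grading b \<odot> dQ m p' + grading (dQ m q) \<odot> b'"
    using bq by (simp add: d.grading_jder pmul_linear algebra_simps)
  also have "\<dots> \<in> Jideal m"
  proof -
    have "(p - dQ m b - q) \<odot> p' \<in> Jideal m" "q \<odot> (p' - dQ m b' - q') \<in> Jideal m"
      "grading b \<odot> dQ m p' \<in> Jideal m" "grading (dQ m q) \<odot> b' \<in> Jideal m"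
      using bq bq' p' dq by (auto intro: Jideal_pmul_left Jideal_pmul_right grading_Jideal)
    then show ?thesis by (intro Jideal.add Jideal_diff)
  qed
  finally have "p \<odot> p' - dQ m ?b - q \<odot> q' \<in> Jideal m" .
  moreover have "dQ m (p \<odot> p') \<in> Jideal m"
    using p p' by (auto simp: d.jder_pmul intro: Jideal.add Jideal_pmul_left Jideal_pmul_right)
  ultimately show ?thesis
    using p p' bq bq' unfolding reducible_def
    by (intro conjI exI[of _ ?b] exI[of _ "q \<odot> q'"]) (auto intro: alg_gen.mul)
qed

text \<open>The traceless part is a combination of components of \<open>T\<close>, hence a finitely
  supported cocycle and a generator. What separates it from \<open>T\<close> is a combination of
  traces of \<open>T\<close>.\<close>

lemma reducible_tensor:
  assumes T: "\<And>i. fin_supp (T i)" "\<And>i. dQ m (T i) \<in> Jideal m"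
    and var: "\<And>T0 i. is_traceless_part k T T0 \<Longrightarrow> length i = k \<Longrightarrow> T0 i \<in> traceless_vars m"
    and trace: "\<And>a b l. a < b \<Longrightarrow> b < k \<Longrightarrow> length l = k \<Longrightarrow> reducible (trace a b T l)"
    and i: "length i = k"
  shows "reducible (T i)"
proof -
  obtain T0 P s where T0: "is_traceless_part k T T0"
    and T0_eq: "\<And>i. T0 i = (\<Sum>j | length j = k. sc (P i j) (T j))"
    and T_eq: "\<And>i. length i = k \<Longrightarrow> T i = T0 i + (\<Sum>(a, b)\<in>{(a, b). a < b \<and> b < k}.
      \<Sum>l | length l = k. sc (s i a b l) (trace a b T l))"
    using traceless_part_exists[of k T] by blast
  have "reducible (T0 i)"
  proof (rule reducible_traceless_var)
    show "T0 i \<in> traceless_vars m" using var[OF T0 i] .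
    show "fin_supp (T0 i)" unfolding T0_eq by (intro fin_supp_sum fin_supp_sc T)
    show "dQ m (T0 i) \<in> Jideal m"
      unfolding T0_eq using T by (auto simp: d.jder_sum d.jder_linear intro!: Jideal_sum Jideal_sc)
  qed
  then show ?thesis
    unfolding T_eq[OF i]
    by (auto intro!: reducible_add reducible_sum reducible_sc trace simp: split_def)
qed

section \<open>The jets of phi\<close>

lemma phic_eq: "phic m a b = jet (Vf b) {#a#} + jet (Vf a) {#b#}
    - sc (eta a b) (\<Sum>r\<in>UNIV. sc (eta r r) (jet (Vf r) {#r#})) - sc (of_real m) (jet (Hf a b) {#})"
  by (simp add: phic_def fv_def D_jet)

lemma linform_phic: "phic m a b \<in> linform False"
  unfolding phic_eq by (intro linform_closed) auto

lemma linform_phitr: "phitr m \<in> linform False"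
  unfolding phitr_def by (intro linform_closed linform_phic)

lemma Dlin_phic: "Dlin ms (phic m a b) = jet (Vf b) (add_mset a ms) + jet (Vf a) (add_mset b ms)
    - sc (eta a b) (\<Sum>r\<in>UNIV. sc (eta r r) (jet (Vf r) (add_mset r ms))) - sc (of_real m) (jet (Hf a b) ms)"
  by (simp add: phic_eq Dlin_linear Dlin_sum Dlin_jet)

lemma dQ_Dlin_phic: "dQ m (Dlin ms (phic m a b)) = 0"
  by (simp add: Dlin_phic d.jder_linear d.jder_sum fin_supp_sum dQ_jet sc_linear sc_sum mult_ac)

lemma dQ_Dlin_phitr: "dQ m (Dlin ms (phitr m)) = 0"
  by (simp add: phitr_def Dlin_sum Dlin_linear d.jder_sum d.jder_linear dQ_Dlin_phic
      fin_supp_linform[OF Dlin_linform[OF linform_phic]])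

lemma phic_sym: "Dlin ms (phic m a b) - Dlin ms (phic m b a) \<in> Jideal m"
proof -
  have "Dlin ms (phic m a b) - Dlin ms (phic m b a) = sc (- of_real m) (jet (Hf a b) ms - jet (Hf b a) ms)"
    by (simp add: Dlin_phic eta_sym[of a b] sc_linear)
  moreover have "jet (Hf a b) ms - jet (Hf b a) ms \<in> Jideal m"
    by (intro rels_Jideal) (unfold rels_def, blast)
  ultimately show ?thesis using Jideal_sc by simp
qed

text \<open>The divergence of phi is the d'Alembertian of v minus m times the divergence of h, and
  \<open>dQ\<close> of i m ut is -m times that divergence minus m^2 v. The difference is the
  Klein-Gordon expression for v.\<close>

lemma div_phic_exact:
  "(\<Sum>r\<in>UNIV. sc (eta r r) (Dlin (add_mset r ms) (phic m a r)))
     - dQ m (sc (\<i> * of_real m) (jet (UTf a) ms)) \<in> Jideal m"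
proof -
  let ?S = "\<lambda>r. \<Sum>s\<in>UNIV. sc (eta s s) (jet (Vf s) (add_mset s (add_mset r ms)))"
  have "(\<Sum>r\<in>UNIV. sc (eta r r) (Dlin (add_mset r ms) (phic m a r)))
    = (\<Sum>r\<in>UNIV. sc (eta r r) (jet (Vf r) (add_mset a (add_mset r ms))))
     + (\<Sum>r\<in>UNIV. sc (eta r r) (jet (Vf a) (ms + {#r, r#}))) - (\<Sum>r\<in>UNIV. sc (eta r r * eta a r) (?S r))
     - sc (of_real m) (div_h a ms)"
    by (simp add: Dlin_phic div_h_def sc_linear sc_sum sum.distrib sum_subtractf sum_negf mult_ac)
  also have "\<dots> = (\<Sum>r\<in>UNIV. sc (eta r r) (jet (Vf a) (ms + {#r, r#}))) - sc (of_real m) (div_h a ms)"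
    unfolding eta_contract by (simp add: add_mset_commute)
  finally have "(\<Sum>r\<in>UNIV. sc (eta r r) (Dlin (add_mset r ms) (phic m a r)))
      - dQ m (sc (\<i> * of_real m) (jet (UTf a) ms))
    = (\<Sum>r\<in>UNIV. sc (eta r r) (jet (Vf a) (ms + {#r, r#}))) + sc (of_real (m\<^sup>2)) (jet (Vf a) ms)"
    by (simp add: d.jder_linear dQ_jet sc_linear power2_eq_square mult_ac i_squared)
  then show ?thesis using Klein_Gordon_jet by simp
qed

lemma reducible_box:
  assumes "p \<in> linform False" "reducible (Dlin ms p)"
  shows "reducible (\<Sum>r\<in>UNIV. sc (eta r r) (Dlin (ms + {#r, r#}) p))"
proof (rule reducible_cong)
  show "reducible (sc (- of_real (m\<^sup>2)) (Dlin ms p))" by (rule reducible_sc) fact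
qed (use linform_Klein_Gordon[OF assms(1), of ms m] in \<open>simp add: sc_linear\<close>)

text \<open>For a trace over two derivative slots: \<open>M\<close> holds the uncontracted
  derivatives, and its smaller size drives the inductions below.\<close>

lemma mset_update2:
  assumes "a < b" "b < length l"
  obtains M where "size M < length l" "\<And>r. mset (l[a := r, b := r]) = M + {#r, r#}"
proof -
  obtain u y zs where l: "l = u @ y # zs" "length u = b"
    using assms(2) id_take_nth_drop[of b l] by (metis length_take min.absorb4)
  obtain xs x ys where u: "u = xs @ x # ys" "length xs = a"
    using assms(1) l(2) id_take_nth_drop[of a u] by (metis length_take min.absorb4)
  have "l[a := r, b := r] = xs @ r # ys @ r # zs" for r
    using l u by (auto simp: list_update_append)
  then show thesis
    using l u by (intro that[of "mset xs + mset ys + mset zs"]) auto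
qed

text \<open>All slots are derivatives, so every trace is a d'Alembertian. This case is settled
  before \<open>reducible_phic\<close>, where the trace over the two tensor slots leads to
  it.\<close>

lemma reducible_phitr: "reducible (Dlin ms (phitr m))"
proof (induction "size ms" arbitrary: ms rule: less_induct)
  case less
  define k where "k = size ms"
  obtain i where i: "mset i = ms" using ex_mset by blast
  have ten: "phitrten m i = Dlin (mset i) (phitr m)" for i
    by (simp add: phitrten_def Dlist_linform[OF linform_phitr])
  have "reducible (phitrten m i)"
  proof (rule reducible_tensor)
    show "fin_supp (phitrten m i)" "dQ m (phitrten m i) \<in> Jideal m" for i
      by (auto simp: ten dQ_Dlin_phitr Jideal.zero fin_supp_linform[OF Dlin_linform[OF linform_phitr]])
    show "length i = k" using i by (auto simp: k_def)
    show "T0 i \<in> traceless_vars m" if "is_traceless_part k (phitrten m) T0" "length i = k" for T0 i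
      using that by (auto simp: traceless_vars_def)
    fix a b and l :: "idx list" assume l: "a < b" "b < k" "length l = k"
    then obtain M where M: "size M < k" "\<And>r. mset (l[a := r, b := r]) = M + {#r, r#}"
      using mset_update2[of a b l] by metis
    then have "reducible (Dlin M (phitr m))" using less by (simp add: k_def)
    then show "reducible (trace a b (phitrten m) l)"
      unfolding trace_def ten M by (rule reducible_box[OF linform_phitr])
  qed
  then show ?case by (simp add: ten i)
qed

lemma reducible_phic: "reducible (Dlin ms (phic m c d))"
proof (induction "size ms" arbitrary: ms c d rule: less_induct)
  case less
  define k where "k = 2 + size ms"
  obtain i where i: "mset i = ms" using ex_mset by blast
  have ten: "phiten m i = Dlin (mset (drop 2 i)) (phic m (i ! 0) (i ! 1))" for i
    by (simp add: phiten_def Dlist_linform[OF linform_phic])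
  have "reducible (phiten m (c # d # i))"
  proof (rule reducible_tensor)
    show "fin_supp (phiten m i)" "dQ m (phiten m i) \<in> Jideal m" for i
      by (auto simp: ten dQ_Dlin_phic Jideal.zero fin_supp_linform[OF Dlin_linform[OF linform_phic]])
    show "length (c # d # i) = k" using i by (auto simp: k_def)
    show "T0 i \<in> traceless_vars m" if "is_traceless_part k (phiten m) T0" "length i = k" for T0 i
      using that by (auto simp: traceless_vars_def k_def)
    fix a b and l :: "idx list" assume ab: "a < b" "b < k" and l: "length l = k"
    then obtain c' d' l' where l': "l = c' # d' # l'" "length l' = size ms"
      by (auto simp: k_def length_Suc_conv)
    have div: "reducible (\<Sum>r\<in>UNIV. sc (eta r r) (Dlin (add_mset r M) (phic m e r)))" for e M
      using reducible_cong[OF reducible_dQ div_phic_exact] by auto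
    \<comment> \<open>\<open>div_phic_exact\<close> contracts the second index of phi; symmetry
      modulo the ideal transfers this to the first.\<close>
    have div': "reducible (\<Sum>r\<in>UNIV. sc (eta r r) (Dlin (add_mset r M) (phic m r e)))" for e M
    proof (rule reducible_cong[OF div])
      show "(\<Sum>r\<in>UNIV. sc (eta r r) (Dlin (add_mset r M) (phic m r e)))
          - (\<Sum>r\<in>UNIV. sc (eta r r) (Dlin (add_mset r M) (phic m e r))) \<in> Jideal m"
        unfolding sum_subtractf[symmetric] sc_linear(2)[symmetric]
        by (intro Jideal_sum Jideal_sc phic_sym)
    qed
    \<comment> \<open>Slots 0 and 1 are the indices of phi and later ones are derivatives: the cases
      are the trace of phi, a divergence in its first or second index, and a contraction of two
      derivatives, which alone uses the induction hypothesis.\<close>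
    consider "a = 0" "b = 1" | b' where "a = 0" "b = Suc (Suc b')" | b' where "a = 1" "b = Suc (Suc b')"
      | a' b' where "a = Suc (Suc a')" "b = Suc (Suc b')"
      using ab by (metis One_nat_def less_nat_zero_code not_less_eq old.nat.exhaust)
    then show "reducible (trace a b (phiten m) l)"
    proof cases
      case 1
      have "trace a b (phiten m) l = Dlin (mset l') (phitr m)"
        by (simp add: trace_def ten l' 1 phitr_def Dlin_sum Dlin_linear)
      then show ?thesis by (simp add: reducible_phitr)
    next
      case 2
      then have "b' < length l'" using ab l l' by simp
      then show ?thesis using div' by (simp add: trace_def ten l' 2 mset_update)
    next
      case 3
      then have "b' < length l'" using ab l l' by simp
      then show ?thesis using div by (simp add: trace_def ten l' 3 mset_update)
    next
      case 4
      then have "a' < b'" "b' < length l'" using ab l l' by simp_all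
      then obtain M where M: "size M < size ms" "\<And>r. mset (l'[a' := r, b' := r]) = M + {#r, r#}"
        using mset_update2[of a' b' l'] l'(2) by metis
      have "reducible (\<Sum>r\<in>UNIV. sc (eta r r) (Dlin (M + {#r, r#}) (phic m c' d')))"
        by (intro reducible_box linform_phic less M)
      then show ?thesis by (simp add: trace_def ten l' 4 M)
    qed
  qed
  then show ?case by (simp add: ten i)
qed

section \<open>Splitting cocycles into eigenvectors\<close>

lemma reducible_Hf: "reducible (jet (Hf a b) ms - proj_h a b ms)"
proof -
  \<comment> \<open>Since \<open>dQ\<close> of -(i/m^2) ut is v/m plus the divergence of h over m^2,
    \<open>dQ m ?b\<close> is 1/m times the v-part of phi, minus \<open>proj_h\<close>. Adding
    -phi/m cancels v and leaves h minus \<open>proj_h\<close>.\<close>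
  let ?b = "sc (- \<i> / of_real (m\<^sup>2)) (jet (UTf b) (add_mset a ms) + jet (UTf a) (add_mset b ms)
    - sc (eta a b) (\<Sum>r\<in>UNIV. sc (eta r r) (jet (UTf r) (add_mset r ms))))"
  have "jet (Hf a b) ms - proj_h a b ms = sc (- 1 / of_real m) (Dlin ms (phic m a b)) + dQ m ?b"
    by (simp add: proj_h_def Dlin_phic d.jder_linear d.jder_sum fin_supp_sum dQ_jet sc_linear sc_sum
        sum.distrib sum_subtractf sum_negf power2_eq_square mult_ac i_squared)
  moreover have "fin_supp ?b" by (auto intro!: fin_supp_sc fin_supp_diff fin_supp_sum)
  ultimately show ?thesis
    by (simp only: reducible_add reducible_sc reducible_phic reducible_dQ)
qed

text \<open>A jet of h need not be an eigenvector; as \<open>N\<close> is a projection there, its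
  image and the complement have eigenvalues 1 and 0. For all other jets \<open>g\<close> is
  0.\<close>

lemma letter_splitting:
  obtains g l where "fin_supp g" "fin_supp l" "var x = g + l" "reducible g" "N g \<in> Jideal m"
    "N l - l \<in> Jideal m"
proof -
  obtain f ms where x: "x = JV f ms" by (cases x)
  have zero: "reducible 0" "N 0 \<in> Jideal m" by (simp_all add: reducible_Jideal N_linear Jideal.zero)
  show thesis
  proof (cases f)
    case (Hf a b)
    have "N (jet (Hf a b) ms - proj_h a b ms) \<in> Jideal m"
      using Jideal_minus[OF N_proj_h] by (simp add: N_linear N_Hf)
    then show thesis
      using reducible_Hf[of a b ms] N_proj_h[of a b ms]
      by (intro that[of "jet (Hf a b) ms - proj_h a b ms" "proj_h a b ms"]) (auto simp: x Hf)
  next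
    case (Vf a)
    then show thesis using zero by (intro that[of 0 "var x"]) (auto simp: x N_Vf Jideal.zero)
  next
    case (Uf a)
    then show thesis using zero N_Uf by (intro that[of 0 "var x"]) (auto simp: x)
  next
    case (UTf a)
    then show thesis using zero by (intro that[of 0 "var x"]) (auto simp: x N_UTf Jideal.zero)
  qed
qed

text \<open>The eigenvector equations hold modulo the ideal, but components beyond \<open>n\<close>
  vanish outright, so two splittings can be extended to a common bound and added.\<close>

definition eigen_splitting :: "nat \<Rightarrow> (nat \<Rightarrow> fpoly) \<Rightarrow> fpoly \<Rightarrow> bool" where
  "eigen_splitting n P p \<longleftrightarrow> (\<forall>j. fin_supp (P j) \<and> N (P j) - sc (of_nat j) (P j) \<in> Jideal m) \<and>
     (\<forall>j>n. P j = 0) \<and> p - (\<Sum>j\<le>n. P j) \<in> Jideal m"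

lemma word_splitting: "\<exists>P. eigen_splitting (length w) P (mono w) \<and> reducible (P 0)"
proof (induction w)
  case Nil
  have "N (mono []) = 0" by (simp add: N_def dQ_eq_oder jder_def oder_def)
  then show ?case
    by (intro exI[of _ "\<lambda>j. if j = 0 then mono [] else 0"])
      (auto simp: eigen_splitting_def reducible_one N_linear Jideal.zero)
next
  case (Cons x w)
  then obtain P where P: "\<And>j. fin_supp (P j)" "\<And>j. N (P j) - sc (of_nat j) (P j) \<in> Jideal m"
    "\<And>j. j > length w \<Longrightarrow> P j = 0" "mono w - (\<Sum>j\<le>length w. P j) \<in> Jideal m" "reducible (P 0)"
    by (auto simp: eigen_splitting_def)
  obtain g l where gl: "fin_supp g" "fin_supp l" "var x = g + l" "reducible g" "N g \<in> Jideal m"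
    "N l - l \<in> Jideal m"
    by (rule letter_splitting)
  \<comment> \<open>As \<open>N\<close> is a derivation, a left factor \<open>g\<close> keeps the
    eigenvalue and \<open>l\<close> raises it by one. Component 0 is thus
    \<open>g \<odot> P 0\<close>, a product of reducible factors.\<close>
  define P' where "P' = (\<lambda>j. g \<odot> P j + (case j of 0 \<Rightarrow> 0 | Suc j \<Rightarrow> l \<odot> P j))"
  have eig0: "N (g \<odot> P j) - sc (of_nat j) (g \<odot> P j) \<in> Jideal m" for j
  proof -
    have "N (g \<odot> P j) - sc (of_nat j) (g \<odot> P j) = N g \<odot> P j + g \<odot> (N (P j) - sc (of_nat j) (P j))"
      using gl P(1) by (simp add: N_pmul pmul_linear)
    also have "\<dots> \<in> Jideal m" using gl P by (intro Jideal.add Jideal_pmul_left Jideal_pmul_right)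
    finally show ?thesis .
  qed
  have eig1: "N (l \<odot> P j) - sc (of_nat (Suc j)) (l \<odot> P j) \<in> Jideal m" for j
  proof -
    have "N (l \<odot> P j) - sc (of_nat (Suc j)) (l \<odot> P j)
        = (N l - l) \<odot> P j + l \<odot> (N (P j) - sc (of_nat j) (P j))"
      using gl P(1) by (simp add: N_pmul pmul_linear sc_linear algebra_simps)
    also have "\<dots> \<in> Jideal m" using gl P by (intro Jideal.add Jideal_pmul_left Jideal_pmul_right)
    finally show ?thesis .
  qed
  have fin: "fin_supp (P' j)" for j
    using gl P(1) by (auto simp: P'_def split: nat.split)
  moreover have "N (P' j) - sc (of_nat j) (P' j) \<in> Jideal m" for j
  proof (cases j)
    case (Suc i)
    have "N (P' j) - sc (of_nat j) (P' j) = (N (g \<odot> P j) - sc (of_nat j) (g \<odot> P j))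
        + (N (l \<odot> P i) - sc (of_nat j) (l \<odot> P i))"
      using gl P(1) by (simp add: P'_def Suc N_linear sc_linear)
    also have "\<dots> \<in> Jideal m" by (intro Jideal.add eig0) (use eig1[of i] Suc in simp)
    finally show ?thesis .
  qed (use eig0[of 0] in \<open>simp add: P'_def\<close>)
  moreover have "P' j = 0" if "j > length (x # w)" for j
    using that P(3) by (auto simp: P'_def split: nat.split)
  moreover have "mono (x # w) - (\<Sum>j\<le>length (x # w). P' j) \<in> Jideal m"
  proof -
    have "(\<Sum>j\<le>length (x # w). P' j) = (\<Sum>j\<le>Suc (length w). g \<odot> P j) + (\<Sum>j\<le>length w. l \<odot> P j)"
      unfolding P'_def sum.distrib by (simp only: length_Cons sum.atMost_Suc_shift[of "case_nat _ _"]) simp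
    also have "\<dots> = var x \<odot> (\<Sum>j\<le>length w. P j)"
      using P(3) by (simp add: gl(3) pmul_linear pmul_sum_right sum.distrib)
    finally have "mono (x # w) - (\<Sum>j\<le>length (x # w). P' j) = var x \<odot> (mono w - (\<Sum>j\<le>length w. P j))"
      by (simp add: mono_Cons pmul_linear)
    then show ?thesis using Jideal_pmul_left[OF P(4)] by simp
  qed
  moreover have "reducible (P' 0)"
    using reducible_pmul[OF gl(4) P(5)] by (simp add: P'_def)
  ultimately show ?case by (auto simp: eigen_splitting_def)
qed

lemma eigen_splitting_exists:
  assumes "fin_supp p" shows "\<exists>n P. eigen_splitting n P p \<and> reducible (P 0)"
  using assms
proof (induction p rule: fin_supp_induct)
  case zero
  then show ?case
    by (intro exI[of _ 0] exI[of _ "\<lambda>_. 0"])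
      (auto simp: eigen_splitting_def N_linear Jideal.zero reducible_Jideal)
next
  case (mono c w)
  obtain P where P: "eigen_splitting (length w) P (mono w)" "reducible (P 0)"
    using word_splitting by blast
  have "eigen_splitting (length w) (\<lambda>j. sc c (P j)) (sc c (mono w))"
    unfolding eigen_splitting_def
  proof (intro conjI allI impI)
    fix j
    show "N (sc c (P j)) - sc (of_nat j) (sc c (P j)) \<in> Jideal m"
      using P Jideal_sc[of "N (P j) - sc (of_nat j) (P j)" m c]
      by (auto simp: eigen_splitting_def N_linear sc_linear mult_ac)
    show "sc c (mono w) - (\<Sum>j\<le>length w. sc c (P j)) \<in> Jideal m"
      using P Jideal_sc[of "mono w - (\<Sum>j\<le>length w. P j)" m c]
      by (auto simp: eigen_splitting_def sc_linear sc_sum)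
  qed (use P in \<open>auto simp: eigen_splitting_def\<close>)
  then show ?case using reducible_sc[OF P(2)] by blast
next
  case (add p q)
  then obtain n P n' P' where P: "eigen_splitting n P p" "reducible (P 0)"
    and P': "eigen_splitting n' P' q" "reducible (P' 0)"
    by blast
  have "eigen_splitting (max n n') (\<lambda>j. P j + P' j) (p + q)"
    unfolding eigen_splitting_def
  proof (intro conjI allI impI)
    fix j
    show "N (P j + P' j) - sc (of_nat j) (P j + P' j) \<in> Jideal m"
      using P P' Jideal.add[of "N (P j) - sc (of_nat j) (P j)" m "N (P' j) - sc (of_nat j) (P' j)"]
      by (auto simp: eigen_splitting_def N_linear sc_linear algebra_simps)
    have "(\<Sum>j\<le>max n n'. P j) = (\<Sum>j\<le>n. P j)" "(\<Sum>j\<le>max n n'. P' j) = (\<Sum>j\<le>n'. P' j)"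
      using P P' by (intro sum.mono_neutral_right; auto simp: eigen_splitting_def)+
    then show "p + q - (\<Sum>j\<le>max n n'. P j + P' j) \<in> Jideal m"
      using P P' Jideal.add[of "p - (\<Sum>j\<le>n. P j)" m "q - (\<Sum>j\<le>n'. P' j)"]
      by (auto simp: eigen_splitting_def sum.distrib algebra_simps)
  qed (use P P' in \<open>auto simp: eigen_splitting_def\<close>)
  then show ?case using reducible_add[OF P(2) P'(2)] by blast
qed

text \<open>On cocycles, subtracting the multiple of N p that kills the top eigenvalue does not change the
  class, because N is homotopic to zero.\<close>

lemma cocycle_cohomologous_eigen_0:
  assumes "eigen_splitting n P p" "fin_supp p" "dQ m p \<in> Jideal m"
  shows "\<exists>b. fin_supp b \<and> p - dQ m b - P 0 \<in> Jideal m"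
  using assms
proof (induction n arbitrary: p P)
  case 0
  then show ?case by (intro exI[of _ 0]) (auto simp: eigen_splitting_def)
next
  case (Suc n)
  \<comment> \<open>The factor \<open>1 - c * of_nat j\<close> vanishes at \<open>j = Suc n\<close>
    and is 1 at \<open>j = 0\<close>: the top component disappears while \<open>P 0\<close> stays
    the same.\<close>
  define c where "c = 1 / complex_of_nat (Suc n)"
  define p' where "p' = p - sc c (N p)"
  define P' where "P' = (\<lambda>j. sc (1 - c * of_nat j) (P j))"
  have P: "\<And>j. fin_supp (P j)" "\<And>j. N (P j) - sc (of_nat j) (P j) \<in> Jideal m"
    "\<And>j. j > Suc n \<Longrightarrow> P j = 0" "p - (\<Sum>j\<le>Suc n. P j) \<in> Jideal m"
    using Suc.prems(1) by (auto simp: eigen_splitting_def)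
  have top: "P' (Suc n) = 0"
  proof -
    have "c * of_nat (Suc n) = 1" unfolding c_def by (simp del: of_nat_Suc)
    then show ?thesis by (simp add: P'_def)
  qed
  have "eigen_splitting n P' p'"
    unfolding eigen_splitting_def
  proof (intro conjI allI impI)
    fix j
    show "fin_supp (P' j)" using P(1) by (simp add: P'_def)
    show "N (P' j) - sc (of_nat j) (P' j) \<in> Jideal m"
      using P(1) Jideal_sc[OF P(2), of "1 - c * of_nat j" j]
      by (simp add: P'_def N_linear sc_linear(1-3) mult_ac)
    show "P' j = 0" if "n < j"
      using that P(3)[of j] top by (cases "j = Suc n") (auto simp: P'_def)
    let ?r = "p - (\<Sum>j\<le>Suc n. P j)"
    have "(\<Sum>j\<le>n. P' j) = (\<Sum>j\<le>Suc n. P' j)" using top by simp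
    also have "\<dots> = (\<Sum>j\<le>Suc n. P j) - sc c (\<Sum>j\<le>Suc n. sc (of_nat j) (P j))"
      unfolding P'_def sc_linear(5) sum_subtractf sc_sum by simp
    moreover have "N ?r = N p - (\<Sum>j\<le>Suc n. N (P j))"
      using P(1) Suc.prems(2) by (simp add: N_linear(3) N_sum fin_supp_sum del: sum.atMost_Suc)
    ultimately have "p' - (\<Sum>j\<le>n. P' j)
        = ?r - sc c (N ?r) - sc c (\<Sum>j\<le>Suc n. N (P j) - sc (of_nat j) (P j))"
      unfolding p'_def by (simp add: sc_linear sum_subtractf del: sum.atMost_Suc)
    also have "\<dots> \<in> Jideal m"
      by (intro Jideal_diff Jideal_sc Jideal_sum N_Jideal P)
    finally show "p' - (\<Sum>j\<le>n. P' j) \<in> Jideal m" .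
  qed
  moreover have "fin_supp p'" using Suc.prems(2) by (simp add: p'_def)
  moreover have "dQ m p' \<in> Jideal m"
  proof -
    have "dQ m p' = dQ m p - sc c (dQ m (dQ m (K p)) + dQ m (K (dQ m p)))"
      using Suc.prems(2) by (simp add: p'_def N_def d.jder_linear)
    also have "\<dots> \<in> Jideal m"
      by (intro Jideal_diff Jideal_sc Jideal.add dQ_dQ d.jder_Jideal k.jder_Jideal Suc.prems)
        (rule k.fin_supp_jder)
    finally show ?thesis .
  qed
  ultimately obtain b where b: "fin_supp b" "p' - dQ m b - P' 0 \<in> Jideal m"
    using Suc.IH by blast
  \<comment> \<open>\<open>sc c (N p)\<close> is \<open>dQ\<close> of \<open>sc c (K p)\<close> plus
    a multiple of \<open>K (dQ m p)\<close>, which lies in the ideal; this dictates the correction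
    of \<open>b\<close>.\<close>
  have "p - dQ m (b + sc c (K p)) - P 0 = (p' - dQ m b - P' 0) + sc c (K (dQ m p))"
    using b(1) by (simp add: p'_def P'_def N_def d.jder_linear sc_linear algebra_simps)
  also have "\<dots> \<in> Jideal m"
    by (intro Jideal.add Jideal_sc b k.jder_Jideal Suc.prems)
  finally show ?case using b(1) by (intro exI[of _ "b + sc c (K p)"]) auto
qed

end

theorem mainTheorem6:
  fixes m :: real and p :: fpoly
  assumes "m > 0"
    and "fin_supp p"
    and "dQ m p \<in> Jideal m"
  shows "\<exists>b q. fin_supp b \<and> q \<in> alg_gen (traceless_vars m) \<and> p - dQ m b - q \<in> Jideal m"
proof -
  interpret massive m by standard fact
  obtain n P where P: "eigen_splitting n P p" "reducible (P 0)"
    using eigen_splitting_exists[OF assms(2)] by blast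
  obtain b where b: "fin_supp b" "p - dQ m b - P 0 \<in> Jideal m"
    using cocycle_cohomologous_eigen_0[OF P(1) assms(2,3)] by blast
  obtain b' q where b': "fin_supp b'" "q \<in> alg_gen (traceless_vars m)" "P 0 - dQ m b' - q \<in> Jideal m"
    using P(2) unfolding reducible_def by blast
  have "p - dQ m (b + b') - q \<in> Jideal m"
    using Jideal.add[OF b(2) b'(3)] b(1) b'(1) by (simp add: d.jder_linear algebra_simps)
  then show ?thesis using b(1) b'(1,2) by blast
qed

end
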